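(* There is a greedy algorithm for MSTBL that, for every instance $(T,\mathcal{T},\vec{k})$, returns a feasible sub-multiset $U\subseteq\mathcal{T}$ with $|\mathrm{OPT}|\le M\,|U|$, where $\mathrm{OPT}$ is an optimal solution, and that runs in polynomial time also when the multiset $\mathcal{T}$ is given in compact form.
   Context: An object of a tree $T$ is a vertex or an edge. For a multiset $S$ and element $e$, $m_S(e)$ denotes the multiplicity of $e$ in $S$; $S'\subseteq S$ means $m_{S'}(e)\le m_S(e)$ for all $e$. A multiset $S$ is given in compact form if it is given by its set of distinct elements together with their multiplicities. For a multiset $U$ of subtrees of $T$ and an object $o$, $\mathrm{load}(U,o)$ is the number of subtrees in $U$, counted with multiplicity, that contain $o$. An instance of MSTBL is a triple $(T,\mathcal{T},\vec{k})$ where $T$ is a tree, $\mathcal{T}$ is a (multi)set of subtrees of $T$ and $\vec{k}$ is a vector of non-negative integers indexed by the objects of $T$; $U\subseteq\mathcal{T}$ is feasible if $\mathrm{load}(U,o)\le k_o$ for every object $o$; the goal is a feasible $U$ of maximum cardinality (counted with multiplicity). $T$ is rooted at an arbitrary fixed vertex $r$; for a subtree $T_i$, $\mathrm{root}(T_i)$ is its vertex closest to $r$, $\mathrm{leaves}(T_i)$ is the number of leaves of $T_i$ other than $\mathrm{root}(T_i)$, and $M=\max_{T_i\in\mathcal{T}}\mathrm{leaves}(T_i)$.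
   Formalization: The bound is |OPT| ≤ max(1, M)·|U| instead of |OPT| ≤ M·|U|: if all subtrees are single vertices then M = 0 and the stated bound fails (one vertex, one subtree, capacity 1). For M ≥ 1 it is unchanged; for M = 0 it says U is optimal. *)

theory Defs
  imports
    "HOL-Library.Multiset"
    "HOL-Library.Discrete_Functions"
    "HOL-Computational_Algebra.Polynomial"
begin

section \<open>Trees, subtrees and objects\<close>

(* A finite simple undirected graph: vertex set and set of two-element edges. *)
type_synonym 'v graph = "'v set \<times> 'v set set"

abbreviation vertices :: "'v graph \<Rightarrow> 'v set" where "vertices \<equiv> fst"
abbreviation edges :: "'v graph \<Rightarrow> 'v set set" where "edges \<equiv> snd"

definition simple_graph :: "'v graph \<Rightarrow> bool" where
  "simple_graph G \<longleftrightarrow>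
     finite (vertices G) \<and> (\<forall>e\<in>edges G. e \<subseteq> vertices G \<and> card e = 2)"

definition walk :: "'v graph \<Rightarrow> 'v list \<Rightarrow> bool" where
  "walk G xs \<longleftrightarrow>
     xs \<noteq> [] \<and> set xs \<subseteq> vertices G \<and> successively (\<lambda>u v. {u, v} \<in> edges G) xs"

definition connected_graph :: "'v graph \<Rightarrow> bool" where
  "connected_graph G \<longleftrightarrow> vertices G \<noteq> {} \<and>
     (\<forall>u\<in>vertices G. \<forall>v\<in>vertices G. \<exists>xs. walk G xs \<and> hd xs = u \<and> last xs = v)"

definition is_cycle :: "'v graph \<Rightarrow> 'v list \<Rightarrow> bool" where
  "is_cycle G xs \<longleftrightarrow>
     walk G xs \<and> distinct xs \<and> length xs \<ge> 3 \<and> {last xs, hd xs} \<in> edges G"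

definition is_tree :: "'v graph \<Rightarrow> bool" where
  "is_tree G \<longleftrightarrow> simple_graph G \<and> connected_graph G \<and> (\<nexists>xs. is_cycle G xs)"

definition subtree :: "'v graph \<Rightarrow> 'v graph \<Rightarrow> bool" where
  "subtree S T \<longleftrightarrow> vertices S \<subseteq> vertices T \<and> edges S \<subseteq> edges T \<and> is_tree S"

datatype 'v object = Vertex 'v | Edge "'v set"

definition objects :: "'v graph \<Rightarrow> 'v object set" where
  "objects G = Vertex ` vertices G \<union> Edge ` edges G"

definition dist :: "'v graph \<Rightarrow> 'v \<Rightarrow> 'v \<Rightarrow> nat" where
  "dist G u v = (LEAST d. \<exists>xs. walk G xs \<and> hd xs = u \<and> last xs = v \<and> length xs = Suc d)"

definition degree_in :: "'v graph \<Rightarrow> 'v \<Rightarrow> nat" where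
  "degree_in G v = card {e \<in> edges G. v \<in> e}"

(* In a tree the vertex of a subtree closest to r is unique. *)
definition root_of :: "'v graph \<Rightarrow> 'v \<Rightarrow> 'v graph \<Rightarrow> 'v" where
  "root_of T r S = (ARG_MIN (dist T r) v. v \<in> vertices S)"

definition leaves :: "'v graph \<Rightarrow> 'v \<Rightarrow> 'v graph \<Rightarrow> nat" where
  "leaves T r S = card {v \<in> vertices S. degree_in S v = 1 \<and> v \<noteq> root_of T r S}"

(* The 0 only matters for the empty multiset.  A one-vertex subtree has no leaf other than its
   root, so the maximum is 0 for a nonempty multiset of one-vertex subtrees; as no bound
   |OPT| <= 0 can hold there, approximation ratios have to be stated with max 1 (max_leaves T r _). *)
definition max_leaves :: "'v graph \<Rightarrow> 'v \<Rightarrow> 'v graph multiset \<Rightarrow> nat" where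
  "max_leaves T r \<T> = Max (insert 0 (leaves T r ` set_mset \<T>))"


section \<open>The problem MSTBL\<close>

(* The capacity vector k is a function on all objects; only its values on objects T matter. *)

definition mstbl_instance ::
    "'v graph \<Rightarrow> 'v graph multiset \<Rightarrow> ('v object \<Rightarrow> nat) \<Rightarrow> bool" where
  "mstbl_instance T \<T> k \<longleftrightarrow> is_tree T \<and> (\<forall>S\<in>#\<T>. subtree S T)"

definition load :: "'v graph multiset \<Rightarrow> 'v object \<Rightarrow> nat" where
  "load U x = size {#S \<in># U. x \<in> objects S#}"

definition feasible ::
    "'v graph \<Rightarrow> ('v object \<Rightarrow> nat) \<Rightarrow> 'v graph multiset \<Rightarrow> bool" where
  "feasible T k U \<longleftrightarrow> (\<forall>x\<in>objects T. load U x \<le> k x)"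

definition optimal ::
    "'v graph \<Rightarrow> 'v graph multiset \<Rightarrow> ('v object \<Rightarrow> nat) \<Rightarrow> 'v graph multiset \<Rightarrow> bool" where
  "optimal T \<T> k U \<longleftrightarrow> U \<subseteq># \<T> \<and> feasible T k U \<and>
     (\<forall>U'. U' \<subseteq># \<T> \<and> feasible T k U' \<longrightarrow> size U' \<le> size U)"


section \<open>Greedy algorithms\<close>

(* Elements are considered one at a time; an element is accepted iff this keeps the
   solution feasible, and decisions are never revised. *)
definition greedy_select ::
    "'v graph \<Rightarrow> ('v object \<Rightarrow> nat) \<Rightarrow> 'v graph list \<Rightarrow> 'v graph multiset" where
  "greedy_select T k Ss =
     foldl (\<lambda>U S. if feasible T k (add_mset S U) then add_mset S U else U) {#} Ss"

(* A greedy algorithm is given by its priority rule, which ranks a subtree on the basis of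
   the rooted tree and the subtree alone.  Subtrees are considered by increasing rank, and
   every way of breaking ties is a legal run. *)
type_synonym 'v rule = "'v graph \<Rightarrow> 'v \<Rightarrow> 'v graph \<Rightarrow> nat"

definition greedy_outputs ::
    "'v rule \<Rightarrow> 'v graph \<Rightarrow> 'v \<Rightarrow> 'v graph multiset \<Rightarrow> ('v object \<Rightarrow> nat)
      \<Rightarrow> 'v graph multiset set" where
  "greedy_outputs rule T r \<T> k =
     {greedy_select T k Ss | Ss. mset Ss = \<T> \<and> sorted (map (rule T r) Ss)}"


section \<open>Model of computation: a structured random access machine with logarithmic cost\<close>

(* Storage consists of finitely many named arrays of natural numbers (those occurring in the
   program); a scalar variable is cell 0 of an array.  There is addition and truncated
   subtraction but no multiplication.  Every operation is charged the bit length of the value it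
   produces, so an array access is charged the bit lengths of both the address and the
   contents.  This is the logarithmic cost criterion, for which polynomial time agrees with
   polynomial time on Turing machines. *)

definition bits :: "nat \<Rightarrow> nat" where
  "bits n = Suc (floor_log n)"

type_synonym store = "string \<Rightarrow> nat \<Rightarrow> nat"

datatype exp = Num nat | Cell string exp | Add exp exp | Monus exp exp

fun val :: "store \<Rightarrow> exp \<Rightarrow> nat" where
  "val s (Num n) = n"
| "val s (Cell x a) = s x (val s a)"
| "val s (Add a b) = val s a + val s b"
| "val s (Monus a b) = val s a - val s b"

fun cost :: "store \<Rightarrow> exp \<Rightarrow> nat" where
  "cost s (Num n) = bits n"
| "cost s (Cell x a) = cost s a + bits (val s (Cell x a))"
| "cost s (Add a b) = cost s a + cost s b + bits (val s (Add a b))"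
| "cost s (Monus a b) = cost s a + cost s b + bits (val s (Monus a b))"

datatype prog =
    Skip
  | Assign string exp exp  (* array, index, new contents *)
  | Seq prog prog
  | If exp prog prog       (* a guard holds iff its value is nonzero *)
  | While exp prog

inductive exec :: "prog \<Rightarrow> store \<Rightarrow> nat \<Rightarrow> store \<Rightarrow> bool" where
  exec_Skip: "exec Skip s 1 s"
| exec_Assign:
    "exec (Assign x a e) s (Suc (cost s a + cost s e)) (s(x := (s x)(val s a := val s e)))"
| exec_Seq: "exec p s t1 s1 \<Longrightarrow> exec q s1 t2 s2 \<Longrightarrow> exec (Seq p q) s (t1 + t2) s2"
| exec_If_true: "val s e \<noteq> 0 \<Longrightarrow> exec p s t s1 \<Longrightarrow> exec (If e p q) s (Suc (cost s e + t)) s1"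
| exec_If_false: "val s e = 0 \<Longrightarrow> exec q s t s1 \<Longrightarrow> exec (If e p q) s (Suc (cost s e + t)) s1"
| exec_While_false: "val s e = 0 \<Longrightarrow> exec (While e p) s (Suc (cost s e)) s"
| exec_While_true:
    "val s e \<noteq> 0 \<Longrightarrow> exec p s t1 s1 \<Longrightarrow> exec (While e p) s1 t2 s2 \<Longrightarrow>
     exec (While e p) s (Suc (cost s e + t1 + t2)) s2"

inductive_cases exec_SkipE: "exec Skip s t s'"
inductive_cases exec_AssignE: "exec (Assign x a e) s t s'"
inductive_cases exec_SeqE: "exec (Seq p q) s t s'"
inductive_cases exec_IfE: "exec (If e p q) s t s'"
inductive_cases exec_WhileE: "exec (While e p) s t s'"

lemma exec_deterministic:
  "exec p s t s' \<Longrightarrow> exec p s u s'' \<Longrightarrow> t = u \<and> s' = s''"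
proof (induction arbitrary: u s'' rule: exec.induct)
  case (exec_Skip s)
  then show ?case by (rule exec_SkipE) simp
next
  case (exec_Assign x a e s)
  then show ?case by (rule exec_AssignE) simp
next
  case (exec_Seq p s t1 s1 q t2 s2)
  from exec_Seq.prems obtain u1 s1' u2
    where *: "exec p s u1 s1'" "exec q s1' u2 s''" "u = u1 + u2"
    by (rule exec_SeqE)
  have "t1 = u1" "s1 = s1'" using exec_Seq.IH(1)[OF *(1)] by blast+
  then show ?case using exec_Seq.IH(2)[of u2 s''] * by blast
next
  case (exec_If_true s e p t s1 q)
  from exec_If_true.prems exec_If_true.hyps(1) obtain u1
    where *: "exec p s u1 s''" "u = Suc (cost s e + u1)"
    by (elim exec_IfE) blast+
  then show ?case using exec_If_true.IH[OF *(1)] by blast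
next
  case (exec_If_false s e q t s1 p)
  have "\<exists>u1. exec q s u1 s'' \<and> u = Suc (cost s e + u1)"
    using exec_If_false.prems exec_If_false.hyps(1) by cases auto
  then obtain u1 where *: "exec q s u1 s''" "u = Suc (cost s e + u1)" by blast
  then show ?case using exec_If_false.IH[OF *(1)] by blast
next
  case (exec_While_false s e p)
  from exec_While_false.prems exec_While_false.hyps show ?case by cases simp_all
next
  case (exec_While_true s e p t1 s1 t2 s2)
  from exec_While_true.prems exec_While_true.hyps(1) obtain u1 s1' u2
    where *: "exec p s u1 s1'" "exec (While e p) s1' u2 s''" "u = Suc (cost s e + u1 + u2)"
    by cases blast+
  have "t1 = u1" "s1 = s1'" using exec_While_true.IH(1)[OF *(1)] by blast+
  then show ?case using exec_While_true.IH(2)[of u2 s''] * by blast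
qed

definition input_store :: "nat list \<Rightarrow> store" where
  "input_store xs = (\<lambda>x i.
     if x = ''in'' then (if i = 0 then length xs
                         else if i \<le> length xs then xs ! (i - 1) else 0)
     else 0)"

definition input_size :: "nat list \<Rightarrow> nat" where
  "input_size xs = sum_list (map bits xs)"

definition output_list :: "nat \<Rightarrow> store \<Rightarrow> nat list" where
  "output_list n s = map (s ''out'') [0..<n]"


section \<open>Encoding of instances\<close>

(* The vertices are 0, ..., n_verts - 1 and edges are referred to by their position in edge_list.
   Each entry of subs gives the vertices and the edge positions of a subtree together with the
   number of copies, so multiplicities (like capacities) contribute only their bit length
   to the input size.  If the listed subtrees are distinct this is the compact form of the
   multiset; since repetitions are permitted, the explicit listing, in which
   all numbers of copies are 1, is covered too. *)
record instance_code =
  n_verts :: nat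
  edge_list :: "(nat \<times> nat) list"
  root_vertex :: nat
  vertex_caps :: "nat list"
  edge_caps :: "nat list"
  subs :: "(nat list \<times> nat list \<times> nat) list"

definition edge_of :: "nat \<times> nat \<Rightarrow> nat set" where
  "edge_of p = {fst p, snd p}"

definition listed_graphs :: "instance_code \<Rightarrow> nat graph list" where
  "listed_graphs c =
     map (\<lambda>(vs, es, m). (set vs, (\<lambda>i. edge_of (edge_list c ! i)) ` set es)) (subs c)"

definition listed_mults :: "instance_code \<Rightarrow> nat list" where
  "listed_mults c = map (\<lambda>(vs, es, m). m) (subs c)"

definition multiset_of :: "'a list \<Rightarrow> nat list \<Rightarrow> 'a multiset" where
  "multiset_of xs ms = (\<Sum>j<length xs. replicate_mset (ms ! j) (xs ! j))"

definition encodes ::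
    "instance_code \<Rightarrow> nat graph \<Rightarrow> nat \<Rightarrow> nat graph multiset \<Rightarrow> (nat object \<Rightarrow> nat) \<Rightarrow> bool" where
  "encodes c T r \<T> k \<longleftrightarrow>
     T = ({..<n_verts c}, edge_of ` set (edge_list c)) \<and>
     distinct (map edge_of (edge_list c)) \<and>
     r = root_vertex c \<and>
     vertex_caps c = map (\<lambda>v. k (Vertex v)) [0..<n_verts c] \<and>
     edge_caps c = map (\<lambda>e. k (Edge (edge_of e))) (edge_list c) \<and>
     (\<forall>(vs, es, m)\<in>set (subs c).
        distinct vs \<and> distinct es \<and> set es \<subseteq> {..<length (edge_list c)} \<and> 0 < m) \<and>
     \<T> = multiset_of (listed_graphs c) (listed_mults c)"

(* Every instance on the vertex set {..<n} has an encoding in compact form. *)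
lemma encoding_exists:
  fixes T :: "nat graph"
  assumes inst: "mstbl_instance T \<T> k" and V: "vertices T = {..<n}"
  shows "\<exists>c. encodes c T r \<T> k \<and> distinct (listed_graphs c)"
proof -
  have simp_T: "simple_graph T"
    using inst by (simp add: mstbl_instance_def is_tree_def)
  have "edges T \<subseteq> Pow (vertices T)"
    using simp_T by (auto simp: simple_graph_def)
  then have "finite (edges T)"
    using simp_T by (meson finite_Pow_iff finite_subset simple_graph_def)
  then obtain L where L: "set L = edges T" "distinct L"
    using finite_distinct_list by blast
  obtain Gs where Gs: "set Gs = set_mset \<T>" "distinct Gs"
    using finite_distinct_list[of "set_mset \<T>"] by blast
  define es where "es = map (\<lambda>e. (Min e, Max e)) L"
  have edge_MM: "edge_of (Min e, Max e) = e" if "e \<in> edges T" for e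
  proof -
    have "card e = 2" using that simp_T by (simp add: simple_graph_def)
    then obtain u v where "e = {u, v}" by (auto simp: card_2_iff)
    then show ?thesis by (auto simp: edge_of_def min_def max_def)
  qed
  have map_es: "map edge_of es = L"
    unfolding es_def using L edge_MM by (auto intro!: map_idI)
  have len: "length es = length L" by (simp add: es_def)
  define sub where "sub = (\<lambda>S :: nat graph. (sorted_list_of_set (vertices S),
     filter (\<lambda>i. L ! i \<in> edges S) [0..<length L], count \<T> S))"
  define c where "c = \<lparr>n_verts = n, edge_list = es, root_vertex = r,
     vertex_caps = map (\<lambda>v. k (Vertex v)) [0..<n],
     edge_caps = map (\<lambda>e. k (Edge (edge_of e))) es, subs = map sub Gs\<rparr>"
  have sub_ok: "(\<lambda>(vs, es', m). (set vs, (\<lambda>i. edge_of (es ! i)) ` set es')) (sub S) = S"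
    if "S \<in># \<T>" for S
  proof -
    have S: "subtree S T" using inst that by (simp add: mstbl_instance_def)
    then have fin: "finite (vertices S)"
      by (simp add: subtree_def is_tree_def simple_graph_def)
    have "edge_of (es ! i) = L ! i" if "i < length L" for i
      using that len map_es by (metis nth_map)
    then have "(\<lambda>i. edge_of (es ! i)) ` {i. i < length L \<and> L ! i \<in> edges S}
        = (\<lambda>i. L ! i) ` {i. i < length L \<and> L ! i \<in> edges S}"
      by (auto intro!: image_cong)
    also have "\<dots> = set L \<inter> edges S"
      by (auto simp: set_conv_nth)
    also have "\<dots> = edges S" using S L by (auto simp: subtree_def)
    finally have "(\<lambda>i. edge_of (es ! i)) ` {i. i < length L \<and> L ! i \<in> edges S} = edges S" .
    moreover have "set (filter (\<lambda>i. L ! i \<in> edges S) [0..<length L])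
        = {i. i < length L \<and> L ! i \<in> edges S}" by auto
    ultimately show ?thesis using fin by (simp add: sub_def)
  qed
  have graphs: "listed_graphs c = Gs"
    unfolding listed_graphs_def c_def using sub_ok Gs(1)
    by (auto simp del: split_paired_All intro!: map_idI simp: comp_def)
  have mults: "listed_mults c = map (count \<T>) Gs"
    by (simp add: listed_mults_def c_def sub_def comp_def)
  have "multiset_of Gs (map (count \<T>) Gs)
      = (\<Sum>j<length Gs. replicate_mset (count \<T> (Gs ! j)) (Gs ! j))"
    by (simp add: multiset_of_def)
  also have "\<dots> = (\<Sum>S\<in>set Gs. replicate_mset (count \<T> S) S)"
    by (rule sum.reindex_bij_betw) (use Gs(2) in \<open>simp add: bij_betw_nth\<close>)
  also have "\<dots> = \<T>"
    unfolding Gs(1)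
    by (rule multiset_eqI) (auto simp: count_sum not_in_iff sum.delta)
  finally have ms: "multiset_of Gs (map (count \<T>) Gs) = \<T>" .
  have "edge_of ` set es = edges T" using map_es L by (metis set_map)
  then have T_eq: "T = ({..<n}, edge_of ` set es)" using V by (simp add: prod_eq_iff)
  have "\<forall>(vs, es', m)\<in>set (subs c).
      distinct vs \<and> distinct es' \<and> set es' \<subseteq> {..<length (edge_list c)} \<and> 0 < m"
  proof -
    have "case sub S of (vs, es', m) \<Rightarrow>
        distinct vs \<and> distinct es' \<and> set es' \<subseteq> {..<length es} \<and> 0 < m" if "S \<in> set Gs" for S
    proof -
      have "0 < count \<T> S" using that Gs(1) by (simp add: count_greater_zero_iff)
      moreover have "set (filter (\<lambda>i. L ! i \<in> edges S) [0..<length L]) \<subseteq> {..<length es}"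
        using len by (simp add: subset_iff)
      ultimately show ?thesis
        by (simp only: sub_def prod.case distinct_sorted_list_of_set distinct_filter distinct_upt simp_thms)
    qed
    then show ?thesis by (simp add: c_def)
  qed
  moreover have "\<T> = multiset_of (listed_graphs c) (listed_mults c)"
    using ms by (simp only: graphs mults)
  ultimately have "encodes c T r \<T> k"
    unfolding encodes_def using T_eq map_es L(2) by (simp add: c_def)
  then show ?thesis using graphs Gs(2) by (intro exI[of _ c]) simp
qed

definition code_list :: "instance_code \<Rightarrow> nat list" where
  "code_list c =
     [n_verts c, length (edge_list c), length (subs c), root_vertex c]
     @ concat (map (\<lambda>(u, v). [u, v]) (edge_list c))
     @ vertex_caps c
     @ edge_caps c
     @ concat (map (\<lambda>(vs, es, m). [m, length vs, length es] @ vs @ es) (subs c))"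

end

(* A subtree whose root is not deeper than that of S contains, with any object x it shares with S,
   the whole path from x up to the root of S.  Hence, if subtrees are considered by decreasing
   depth of their roots, accepting S forces out at most one remaining subtree of a solution per
   leaf of S: one containing the lowest overloaded object on the path from that leaf to the root.

   The running time is first counted in unit-cost steps.  The program only assigns expressions
   whose values exceed the largest stored number by at most a bounded multiple of the largest
   input number, so after polynomially many steps all numbers still have polynomially many bits. *)

theory Submission
  imports Defs
begin

section \<open>Rooted trees\<close>

text \<open>Multiplicities can be exponential in the input size, so copies cannot be considered one
  at a time. The copies of an entry share its rank and every way of breaking ties is legal, so they
  may be considered consecutively; greedy selection then accepts the minimum of the multiplicity and
  the residual capacities on the subtree, which takes one pass over its objects. In place of
  sorting, the program makes one pass over the entries per rank: ranks are smaller than the number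
  of vertices, which is at most the input size because a capacity is listed for every vertex.

  The trees carry no parent structure. It is recovered from distances to \<open>r\<close>, and
  acyclicity enters only as the impossibility of joining two distinct neighbours of a vertex by a
  walk that avoids this vertex. The ratio is carried by the potential
  \<open>size W + M * size U\<close>, where \<open>W\<close> is what is left of a solution
  compatible with the current selection \<open>U\<close>.\<close>

lemma simple_graph_edgeD:
  assumes "simple_graph G" and "{u, v} \<in> edges G"
  shows "u \<noteq> v" "u \<in> vertices G" "v \<in> vertices G"
proof -
  have "card {u, v} = 2" "{u, v} \<subseteq> vertices G"
    using assms by (auto simp: simple_graph_def)
  then show "u \<noteq> v" "u \<in> vertices G" "v \<in> vertices G"
    by (auto simp: card_insert_if split: if_splits)
qed

text \<open>Adjacency after deleting \<open>z\<close>. Working with its reflexive transitive closure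
  lets walks be joined by transitivity and reversed by symmetry; they are turned into lists only
  where a cycle has to be exhibited.\<close>

definition avoiding :: "'v graph \<Rightarrow> 'v \<Rightarrow> ('v \<times> 'v) set" where
  "avoiding G z = {(a, b). {a, b} \<in> edges G \<and> a \<noteq> z \<and> b \<noteq> z}"

lemma sym_avoiding: "sym (avoiding G z)"
  by (auto simp: avoiding_def sym_def insert_commute)

lemma avoiding_rtrancl_commute:
  "(u, v) \<in> (avoiding G z)\<^sup>* \<Longrightarrow> (v, u) \<in> (avoiding G z)\<^sup>*"
  using sym_rtrancl[OF sym_avoiding] by (metis symD)

lemma successively_avoiding:
  assumes "successively (\<lambda>u v. {u, v} \<in> edges G) xs" and "z \<notin> set xs" and "xs \<noteq> []"
  shows "(hd xs, last xs) \<in> (avoiding G z)\<^sup>*"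
  using assms
proof (induction xs)
  case (Cons x xs)
  show ?case
  proof (cases "xs = []")
    case False
    then have "(x, hd xs) \<in> avoiding G z"
      using Cons.prems by (auto simp: avoiding_def successively_Cons)
    moreover have "(hd xs, last xs) \<in> (avoiding G z)\<^sup>*"
      using Cons False by (auto simp: successively_Cons)
    ultimately show ?thesis using False by (simp add: converse_rtrancl_into_rtrancl)
  qed simp
qed simp

text \<open>Cycles are distinct lists, so loops must be cut out: a step to a vertex already visited
  truncates the walk at that visit.\<close>

lemma avoiding_distinct_walk:
  assumes G: "simple_graph G" and "(x, y) \<in> (avoiding G z)\<^sup>*" and "x \<in> vertices G" and "x \<noteq> z"
  shows "\<exists>xs. walk G xs \<and> distinct xs \<and> hd xs = x \<and> last xs = y \<and> z \<notin> set xs"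
  using assms(2)
proof (induction rule: rtrancl_induct)
  case base
  show ?case using assms by (intro exI[of _ "[x]"]) (simp add: walk_def)
next
  case (step y y')
  then obtain xs where xs: "walk G xs" "distinct xs" "hd xs = x" "last xs = y" "z \<notin> set xs"
    by blast
  have e: "{y, y'} \<in> edges G" "y' \<noteq> z" using step by (auto simp: avoiding_def)
  show ?case
  proof (cases "y' \<in> set xs")
    case True
    then obtain as bs where "xs = as @ y' # bs" by (meson split_list)
    then show ?thesis using xs
      by (intro exI[of _ "as @ [y']"])
        (auto simp: walk_def successively_append_iff hd_append split: if_splits)
  next
    case False
    then show ?thesis using xs e simple_graph_edgeD[OF G e(1)]
      by (intro exI[of _ "xs @ [y']"])
        (auto simp: walk_def successively_append_iff hd_append)
  qed
qed

text \<open>Otherwise a walk between two neighbours of \<open>z\<close> would close a cycle through \<open>z\<close>.\<close>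

lemma tree_no_bypass:
  assumes G: "is_tree G" and e: "{z, x} \<in> edges G" "{z, y} \<in> edges G"
    and "(x, y) \<in> (avoiding G z)\<^sup>*"
  shows "x = y"
proof (rule ccontr)
  assume "x \<noteq> y"
  have sg: "simple_graph G" using G by (simp add: is_tree_def)
  note ex = simple_graph_edgeD[OF sg e(1)]
  obtain xs where xs: "walk G xs" "distinct xs" "hd xs = x" "last xs = y" "z \<notin> set xs"
    using avoiding_distinct_walk[OF sg assms(4) ex(3)] ex(1) by blast
  have ne: "xs \<noteq> []" using xs by (simp add: walk_def)
  then have "length xs \<ge> 2"
    using xs \<open>x \<noteq> y\<close> by (cases xs; cases "tl xs") auto
  then have "is_cycle G (z # xs)"
    using xs e ex ne by (auto simp: is_cycle_def walk_def successively_Cons insert_commute)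
  then show False using G by (simp add: is_tree_def)
qed

section \<open>Depths and parents in a rooted tree\<close>

locale rooted_tree =
  fixes T :: "'v graph" and r :: 'v
  assumes tree: "is_tree T" and root: "r \<in> vertices T"
begin

abbreviation depth :: "'v \<Rightarrow> nat" where "depth \<equiv> dist T r"

lemma simple: "simple_graph T"
  using tree by (simp add: is_tree_def)

lemma finite_vertices: "finite (vertices T)"
  using simple by (simp add: simple_graph_def)

lemmas edgeD = simple_graph_edgeD[OF simple]

lemma depth_walk:
  assumes "v \<in> vertices T"
  shows "\<exists>xs. walk T xs \<and> hd xs = r \<and> last xs = v \<and> length xs = Suc (depth v)"
  unfolding dist_def
proof (rule LeastI_ex)
  obtain xs where "walk T xs" "hd xs = r" "last xs = v"
    using tree root assms unfolding is_tree_def connected_graph_def by blast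
  then show "\<exists>d xs. walk T xs \<and> hd xs = r \<and> last xs = v \<and> length xs = Suc d"
    by (intro exI[of _ "length xs - 1"] exI[of _ xs]) (simp add: walk_def)
qed

lemma depth_le:
  assumes "walk T xs" "hd xs = r" "last xs = v" "length xs \<le> Suc n"
  shows "depth v \<le> n"
proof -
  have "xs \<noteq> []" using assms by (simp add: walk_def)
  then have "depth v \<le> length xs - 1"
    unfolding dist_def using assms by (intro Least_le exI[of _ xs]) simp
  then show ?thesis using assms by simp
qed

lemma depth_root [simp]: "depth r = 0"
  using depth_le[of "[r]" r 0] root by (simp add: walk_def)

lemma depth_0D:
  assumes "v \<in> vertices T" "depth v = 0"
  shows "v = r"
proof -
  obtain xs where "hd xs = r" "last xs = v" "length xs = Suc 0"
    using depth_walk[OF assms(1)] assms(2) by auto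
  then show ?thesis by (cases xs) auto
qed

lemma depth_edge:
  assumes "{u, v} \<in> edges T"
  shows "depth v \<le> Suc (depth u)"
proof -
  obtain xs where "walk T xs" "hd xs = r" "last xs = u" "length xs = Suc (depth u)"
    using depth_walk edgeD[OF assms] by blast
  then show ?thesis
    using assms edgeD[OF assms]
    by (intro depth_le[of "xs @ [v]"]) (auto simp: walk_def successively_append_iff hd_append)
qed

text \<open>The predecessor of \<open>v\<close> on a shortest walk from \<open>r\<close>.\<close>

lemma parent_exists:
  assumes "v \<in> vertices T" "v \<noteq> r"
  shows "\<exists>u. {u, v} \<in> edges T \<and> depth v = Suc (depth u)"
proof -
  obtain xs where xs: "walk T xs" "hd xs = r" "last xs = v" "length xs = Suc (depth v)"
    using depth_walk assms by blast
  obtain ys where ys: "xs = ys @ [v]"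
    using xs by (metis append_butlast_last_id walk_def)
  have "ys \<noteq> []" using ys xs assms by auto
  then have *: "walk T ys" "hd ys = r" "{last ys, v} \<in> edges T"
    using xs ys by (auto simp: walk_def successively_append_iff)
  have "depth (last ys) \<le> depth v - 1"
    using depth_le[OF *(1,2) refl] xs ys \<open>ys \<noteq> []\<close> by (cases ys) auto
  moreover have "depth v \<noteq> 0" using assms depth_0D by blast
  ultimately show ?thesis using * depth_edge[OF *(3)] by (intro exI[of _ "last ys"]) auto
qed

text \<open>Ancestors of \<open>v\<close> are strictly less deep than \<open>v\<close>, hence than
  \<open>z\<close>, so the ascent to \<open>r\<close> never meets \<open>z\<close>. Via
  \<open>r\<close>, any two vertices other than \<open>z\<close> and no deeper than \<open>z\<close>
  are therefore connected off \<open>z\<close>; this is the premise that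
  \<open>tree_no_bypass\<close> asks for.\<close>

lemma reach_root_avoiding:
  assumes "v \<in> vertices T" "v \<noteq> z" "depth v \<le> depth z"
  shows "(v, r) \<in> (avoiding T z)\<^sup>*"
  using assms
proof (induction "depth v" arbitrary: v)
  case 0
  then show ?case using depth_0D by auto
next
  case (Suc n)
  then have "v \<noteq> r" by auto
  then obtain u where u: "{u, v} \<in> edges T" "depth v = Suc (depth u)"
    using parent_exists Suc by blast
  then have "u \<noteq> z" "u \<in> vertices T" using Suc edgeD by auto
  then have "(u, r) \<in> (avoiding T z)\<^sup>*" using Suc u by simp
  moreover have "(v, u) \<in> avoiding T z"
    using u \<open>u \<noteq> z\<close> Suc by (simp add: avoiding_def insert_commute)
  ultimately show ?case by (rule converse_rtrancl_into_rtrancl[rotated])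
qed

lemma reach_avoiding:
  assumes "u \<in> vertices T" "u \<noteq> z" "depth u \<le> depth z"
    and "v \<in> vertices T" "v \<noteq> z" "depth v \<le> depth z"
  shows "(u, v) \<in> (avoiding T z)\<^sup>*"
  using reach_root_avoiding[OF assms(1-3)] reach_root_avoiding[OF assms(4-6)]
  by (meson avoiding_rtrancl_commute rtrancl_trans)

lemma parent_unique:
  assumes "{u, v} \<in> edges T" "{w, v} \<in> edges T" "depth u < depth v" "depth w < depth v"
  shows "u = w"
  using assms edgeD[OF assms(1)] edgeD[OF assms(2)]
  by (intro tree_no_bypass[OF tree, of v] reach_avoiding) (auto simp: insert_commute)

text \<open>Otherwise \<open>v\<close> and a parent of \<open>u\<close> would both be neighbours of
  \<open>u\<close>, no deeper than \<open>u\<close>, hence connected off \<open>u\<close> and equal,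
  although their depths differ.\<close>

lemma depth_edge_neq:
  assumes e: "{u, v} \<in> edges T"
  shows "depth u \<noteq> depth v"
proof
  assume eq: "depth u = depth v"
  note uv = edgeD[OF e]
  have "u \<noteq> r" using eq uv depth_0D[of v] by auto
  then obtain p where p: "{p, u} \<in> edges T" "depth u = Suc (depth p)"
    using parent_exists uv by blast
  have "v = p"
    using e p uv eq edgeD[OF p(1)]
    by (intro tree_no_bypass[OF tree, of u] reach_avoiding) (auto simp: insert_commute)
  then show False using p eq by simp
qed

text \<open>For \<open>r\<close>, whose depth is 0, no \<open>u\<close> qualifies and
  \<open>parent r\<close> is an arbitrary value; this is why facts about \<open>parent v\<close>
  assume \<open>v \<noteq> r\<close>.\<close>

definition parent :: "'v \<Rightarrow> 'v" where
  "parent v = (SOME u. {u, v} \<in> edges T \<and> depth v = Suc (depth u))"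

lemma parent:
  assumes "v \<in> vertices T" "v \<noteq> r"
  shows "{parent v, v} \<in> edges T" "depth v = Suc (depth (parent v))" "parent v \<in> vertices T"
  using someI_ex[OF parent_exists[OF assms]] edgeD unfolding parent_def by blast+

lemma edge_parent:
  assumes e: "{u, v} \<in> edges T"
  obtains "v \<noteq> r" "u = parent v" | "u \<noteq> r" "v = parent u"
proof -
  note uv = edgeD[OF e]
  consider "depth u < depth v" | "depth v < depth u"
    using depth_edge_neq[OF e] by linarith
  then show ?thesis
  proof cases
    case 1
    then have "v \<noteq> r" by auto
    moreover from this have "u = parent v"
      using parent[OF uv(3)] e 1 by (intro parent_unique[of u v]) auto
    ultimately show ?thesis using that by blast
  next
    case 2
    then have "u \<noteq> r" by auto
    moreover from this have "v = parent u"
      using parent[OF uv(2)] e 2 by (intro parent_unique[of v u]) (auto simp: insert_commute)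
    ultimately show ?thesis using that by blast
  qed
qed

text \<open>The ascent from \<open>v\<close> to \<open>r\<close> meets every depth up to
  \<open>depth v\<close>. The bound keeps the truncated subtraction in the priority rule exact and
  limits the number of rounds of the program.\<close>

lemma depth_less_card:
  assumes "v \<in> vertices T"
  shows "depth v < card (vertices T)"
proof -
  have "{..depth v} \<subseteq> depth ` vertices T"
    using assms
  proof (induction "depth v" arbitrary: v)
    case 0
    then show ?case using root by force
  next
    case (Suc n)
    then have "v \<noteq> r" by auto
    note p = parent[OF Suc.prems this]
    then have "{..n} \<subseteq> depth ` vertices T"
      using Suc.hyps(1)[of "parent v"] Suc.hyps(2) by simp
    moreover have "Suc n \<in> depth ` vertices T" unfolding Suc.hyps(2) using Suc.prems by (rule imageI)
    ultimately show ?case by (simp add: atMost_Suc flip: Suc.hyps(2))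
  qed
  then have "card {..depth v} \<le> card (vertices T)"
    using card_mono[of "depth ` vertices T"] card_image_le[OF finite_vertices]
    by (meson finite_imageI finite_vertices le_trans)
  then show ?thesis by simp
qed

section \<open>Subtrees, their closest vertices, and upward paths inside them\<close>

abbreviation top_of :: "'v graph \<Rightarrow> 'v" where "top_of \<equiv> root_of T r"

lemma top_of:
  assumes "subtree S T"
  shows "top_of S \<in> vertices S" "v \<in> vertices S \<Longrightarrow> depth (top_of S) \<le> depth v"
proof -
  obtain w where "w \<in> vertices S"
    using assms by (auto simp: subtree_def is_tree_def connected_graph_def)
  then show "top_of S \<in> vertices S" "v \<in> vertices S \<Longrightarrow> depth (top_of S) \<le> depth v"
    unfolding root_of_def by (rule arg_min_natI, intro arg_min_nat_le)
qed

text \<open>A walk inside \<open>S\<close> from \<open>v\<close> to its top leaves \<open>v\<close>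
  for the last time through a neighbour that is then connected to the top off \<open>v\<close>. The
  top is no deeper than \<open>v\<close>, hence also connected to \<open>parent v\<close> off
  \<open>v\<close>, so acyclicity identifies that neighbour with \<open>parent v\<close>.\<close>

lemma subtree_parent:
  assumes S: "subtree S T" and v: "v \<in> vertices S" "v \<noteq> top_of S"
  shows "v \<noteq> r" "parent v \<in> vertices S" "{parent v, v} \<in> edges S"
proof -
  have sub: "vertices S \<subseteq> vertices T" "edges S \<subseteq> edges T" "simple_graph S"
    using S by (auto simp: subtree_def is_tree_def)
  have top: "top_of S \<in> vertices S" "depth (top_of S) \<le> depth v"
    using top_of[OF S] v by auto
  show "v \<noteq> r"
  proof
    assume "v = r"
    then have "depth (top_of S) = 0" using top by simp
    then have "top_of S = r" using depth_0D top sub by blast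
    then show False using v \<open>v = r\<close> by simp
  qed
  have vT: "v \<in> vertices T" using v sub by auto
  note p = parent[OF vT \<open>v \<noteq> r\<close>]
  obtain xs where xs: "walk S xs" "hd xs = v" "last xs = top_of S"
    using S v top unfolding subtree_def is_tree_def connected_graph_def by blast
  then have "v \<in> set xs" by (metis hd_in_set walk_def)
  then obtain as bs where ab: "xs = as @ v # bs" "v \<notin> set bs" by (meson split_list_last)
  then have "bs \<noteq> []" using xs v by auto
  then have b: "{v, hd bs} \<in> edges S" "successively (\<lambda>u v. {u, v} \<in> edges S) bs"
      "last bs = top_of S"
    using xs ab by (auto simp: walk_def successively_append_iff successively_Cons)
  have "successively (\<lambda>u v. {u, v} \<in> edges T) bs"
    using b(2) by (rule successively_mono) (use sub in auto)
  then have "(hd bs, top_of S) \<in> (avoiding T v)\<^sup>*"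
    using successively_avoiding[of T bs v] ab \<open>bs \<noteq> []\<close> b by simp
  moreover have "(top_of S, parent v) \<in> (avoiding T v)\<^sup>*"
    using top(1) sub(1) v(2) by (intro reach_avoiding p(3) top(2)) (use p(2) in auto)
  ultimately have "(hd bs, parent v) \<in> (avoiding T v)\<^sup>*" by (rule rtrancl_trans)
  then have "hd bs = parent v"
    using b p sub by (intro tree_no_bypass[OF tree, of v]) (auto simp: insert_commute)
  then show "{parent v, v} \<in> edges S" using b by (simp add: insert_commute)
  then show "parent v \<in> vertices S" using simple_graph_edgeD[OF sub(3)] by blast
qed

text \<open>The path from \<open>v\<close> towards the root, with vertices at even and edges at odd
  positions. A single index orders both kinds of object, and a depth difference of \<open>d\<close>
  is an index difference of \<open>2 * d\<close>.\<close>

definition chain :: "'v \<Rightarrow> nat \<Rightarrow> 'v object" where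
  "chain v i = (let u = (parent ^^ (i div 2)) v in
     if even i then Vertex u else Edge {parent u, u})"

lemma chain_double [simp]: "chain v (2 * i) = Vertex ((parent ^^ i) v)"
  by (simp add: chain_def)

lemma chain_Suc_double [simp]:
  "chain v (Suc (2 * i)) = Edge {parent ((parent ^^ i) v), (parent ^^ i) v}"
  by (simp add: chain_def Let_def)

lemma funpow_parent:
  assumes "v \<in> vertices T" "i \<le> depth v"
  shows "(parent ^^ i) v \<in> vertices T \<and> depth ((parent ^^ i) v) = depth v - i"
  using assms(2)
proof (induction i)
  case (Suc i)
  then have "depth ((parent ^^ i) v) \<noteq> 0" by simp
  then have "(parent ^^ i) v \<noteq> r" by (rule contrapos_nn) simp
  then show ?case using parent[of "(parent ^^ i) v"] Suc by simp
qed (use assms in simp)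

text \<open>The bound on \<open>i\<close> places a vertex at an even position strictly below the top
  of \<open>S\<close>, so \<open>subtree_parent\<close> supplies the next edge; an edge at an odd
  position brings its upper endpoint along.\<close>

lemma chain_step:
  assumes S: "subtree S T" and v: "v \<in> vertices T" and "chain v i \<in> objects S"
    and i: "i < 2 * (depth v - depth (top_of S))"
  shows "chain v (Suc i) \<in> objects S"
proof -
  have sg: "simple_graph S" using S by (auto simp: subtree_def is_tree_def)
  consider j where "i = 2 * j" | j where "i = Suc (2 * j)"
    by (cases "even i") (auto elim!: evenE oddE)
  then show ?thesis
  proof cases
    case (1 j)
    let ?u = "(parent ^^ j) v"
    have "?u \<in> vertices S" using assms 1 by (auto simp: objects_def)
    moreover have "depth ?u = depth v - j" "j < depth v - depth (top_of S)"
      using funpow_parent[OF v, of j] i 1 by auto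
    then have "?u \<noteq> top_of S" by auto
    ultimately show ?thesis using subtree_parent[OF S] 1 by (auto simp: objects_def)
  next
    case (2 j)
    then have "{parent ((parent ^^ j) v), (parent ^^ j) v} \<in> edges S"
      using assms by (auto simp: objects_def)
    then have "(parent ^^ Suc j) v \<in> vertices S" using simple_graph_edgeD[OF sg] by simp
    moreover have "Suc i = 2 * Suc j" using 2 by simp
    ultimately show ?thesis by (simp only: chain_double) (simp add: objects_def)
  qed
qed

lemma chain_mono:
  assumes S: "subtree S T" and v: "v \<in> vertices T" and "chain v i \<in> objects S"
    and "i \<le> j" "j \<le> 2 * (depth v - depth (top_of S))"
  shows "chain v j \<in> objects S"
  using assms(4,5)
proof (induction j rule: dec_induct)
  case (step j)
  then show ?case using chain_step[OF S v, of j] by simp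
qed (use assms in simp)

text \<open>The starting points of the chains that cover \<open>S\<close>. A one-vertex subtree has
  no leaf besides its root, and the fallback gives it one chain; this is the origin of
  \<open>max 1\<close> in the ratio.\<close>

definition tips :: "'v graph \<Rightarrow> 'v set" where
  "tips S = (let L = {v \<in> vertices S. degree_in S v = 1 \<and> v \<noteq> top_of S} in
     if L = {} then {top_of S} else L)"

lemma tips:
  assumes "subtree S T"
  shows "tips S \<subseteq> vertices S" "finite (tips S)" "card (tips S) = max 1 (leaves T r S)"
proof -
  have fin: "finite (vertices S)"
    using assms by (auto simp: subtree_def is_tree_def simple_graph_def)
  show "tips S \<subseteq> vertices S" using top_of[OF assms] by (auto simp: tips_def Let_def)
  then show "finite (tips S)" using fin finite_subset by blast
  let ?L = "{v \<in> vertices S. degree_in S v = 1 \<and> v \<noteq> top_of S}"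
  have "finite ?L" using fin by simp
  then have "?L \<noteq> {} \<Longrightarrow> 1 \<le> card ?L" by (simp add: Suc_le_eq card_gt_0_iff)
  moreover have "leaves T r S = card ?L" by (simp add: leaves_def)
  moreover have "tips S = (if ?L = {} then {top_of S} else ?L)" unfolding tips_def Let_def ..
  ultimately show "card (tips S) = max 1 (leaves T r S)"
    by (cases "?L = {}") (simp_all only: if_True if_False, simp_all)
qed

text \<open>From the top every edge of \<open>S\<close> leads down, as the top has minimal depth.
  Any other vertex has its parent edge in \<open>S\<close>, so a degree other than 1 yields a second
  edge, and that one leads to a child.\<close>

lemma tip_or_child:
  assumes S: "subtree S T" and v: "v \<in> vertices S" "v \<notin> tips S"
  shows "\<exists>w \<in> vertices S. w \<noteq> r \<and> parent w = v"
proof -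
  have sub: "edges S \<subseteq> edges T" "simple_graph S"
    using S by (auto simp: subtree_def is_tree_def)
  show ?thesis
  proof (cases "v = top_of S")
    case True
    then obtain l where l: "l \<in> vertices S" "l \<noteq> v"
      using v by (auto simp: tips_def Let_def split: if_splits)
    obtain xs where xs: "walk S xs" "hd xs = v" "last xs = l"
      using S v l unfolding subtree_def is_tree_def connected_graph_def by blast
    then obtain x y ys where "xs = x # y # ys"
      using l by (cases xs; cases "tl xs") (auto simp: walk_def)
    then have e: "{v, y} \<in> edges S" using xs by (auto simp: walk_def)
    then have y: "y \<in> vertices S" "y \<noteq> v" using simple_graph_edgeD[OF sub(2)] by blast+
    then have "depth v \<le> depth y" using top_of[OF S] True by simp
    have "{v, y} \<in> edges T" using e sub by auto
    then show ?thesis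
    proof (cases rule: edge_parent)
      case 2
      have "v \<in> vertices T" using v S by (auto simp: subtree_def)
      then show ?thesis using parent[of v] 2 \<open>depth v \<le> depth y\<close> by simp
    qed (use y in auto)
  next
    case False
    note p = subtree_parent[OF S v(1) False]
    have "degree_in S v \<noteq> 1"
      using v False by (auto simp: tips_def Let_def split: if_splits)
    moreover have "{parent v, v} \<in> {e \<in> edges S. v \<in> e}" using p by simp
    ultimately obtain e where e: "e \<in> edges S" "v \<in> e" "e \<noteq> {parent v, v}"
      unfolding degree_in_def by (metis (no_types, lifting) is_singletonI' is_singleton_altdef empty_iff mem_Collect_eq)
    then have "card e = 2" using sub by (auto simp: simple_graph_def)
    then obtain w where w: "e = {v, w}" using e(2) by (auto simp: card_2_iff)
    then have "{v, w} \<in> edges T" using e sub by auto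
    then show ?thesis
    proof (cases rule: edge_parent)
      case 1
      then show ?thesis using simple_graph_edgeD[OF sub(2)] e w by blast
    next
      case 2
      then show ?thesis using e w by (simp add: insert_commute)
    qed
  qed
qed

lemma vertex_on_chain:
  assumes S: "subtree S T" and "v \<in> vertices S"
  shows "\<exists>l \<in> tips S. \<exists>i. i \<le> depth l - depth (top_of S) \<and> v = (parent ^^ i) l"
  using assms(2)
\<comment> \<open>The induction descends to children until a tip is met; depths are bounded by
  \<open>depth_less_card\<close>.\<close>
proof (induction "card (vertices T) - depth v" arbitrary: v rule: less_induct)
  case less
  have VT: "vertices S \<subseteq> vertices T" using S by (auto simp: subtree_def)
  show ?case
  proof (cases "v \<in> tips S")
    case True
    then show ?thesis by (intro bexI[of _ v] exI[of _ 0]) auto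
  next
    case False
    then obtain w where w: "w \<in> vertices S" "w \<noteq> r" "parent w = v"
      using tip_or_child[OF S less.prems] by blast
    have d: "depth w = Suc (depth v)" using parent[of w] w VT by auto
    have "card (vertices T) - depth w < card (vertices T) - depth v"
      using d depth_less_card[of v] less.prems VT by auto
    then obtain l i where li: "l \<in> tips S" "i \<le> depth l - depth (top_of S)" "w = (parent ^^ i) l"
      using less.hyps w by blast
    have "l \<in> vertices T" using li tips[OF S] VT by auto
    then have "depth w = depth l - i" using funpow_parent[of l i] li by auto
    moreover have "depth (top_of S) \<le> depth v" using top_of[OF S] less.prems by simp
    ultimately show ?thesis using li w d
      by (intro bexI[of _ l] exI[of _ "Suc i"]) auto
  qed
qed

lemma object_on_chain:
  assumes S: "subtree S T" and "x \<in> objects S"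
  shows "\<exists>l \<in> tips S. \<exists>i. i \<le> 2 * (depth l - depth (top_of S)) \<and> x = chain l i"
proof -
  have VT: "vertices S \<subseteq> vertices T" "edges S \<subseteq> edges T" and sg: "simple_graph S"
    using S by (auto simp: subtree_def is_tree_def)
  consider v where "v \<in> vertices S" "x = Vertex v" | e where "e \<in> edges S" "x = Edge e"
    using assms by (auto simp: objects_def)
  then show ?thesis
  proof cases
    case (1 v)
    then obtain l i where "l \<in> tips S" "i \<le> depth l - depth (top_of S)" "v = (parent ^^ i) l"
      using vertex_on_chain[OF S] by blast
    then show ?thesis using 1 by (intro bexI[of _ l] exI[of _ "2 * i"]) auto
  next
    case (2 e)
    then have "card e = 2" using sg by (auto simp: simple_graph_def)
    then obtain u v where uv: "e = {u, v}" by (auto simp: card_2_iff)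
    then have e: "{u, v} \<in> edges S" "{u, v} \<in> edges T" using 2 VT by auto
    obtain w where w: "w \<in> vertices S" "w \<noteq> r" "e = {parent w, w}" "parent w \<in> vertices S"
      using e(2)
      by (cases rule: edge_parent) (use uv e simple_graph_edgeD[OF sg e(1)] in \<open>auto simp: insert_commute\<close>)
    have d: "depth w = Suc (depth (parent w))" using parent[of w] w VT by auto
    \<comment> \<open>As the upper endpoint also lies in \<open>S\<close>, the lower endpoint
      \<open>w\<close> is strictly below the top, which leaves room for the odd index
      \<open>Suc (2 * i)\<close>.\<close>
    moreover have "depth (top_of S) \<le> depth (parent w)" using top_of[OF S] w by simp
    moreover obtain l i where li: "l \<in> tips S" "i \<le> depth l - depth (top_of S)" "w = (parent ^^ i) l"
      using vertex_on_chain[OF S w(1)] by blast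
    moreover have "l \<in> vertices T" using li tips[OF S] VT by auto
    then have "depth w = depth l - i" using funpow_parent[of l i] li by auto
    ultimately show ?thesis using 2 w
      by (intro bexI[of _ l] exI[of _ "Suc (2 * i)"]) auto
  qed
qed

end


section \<open>The greedy rule and its approximation ratio\<close>

lemma load_empty [simp]: "load {#} x = 0"
  by (simp add: load_def)

lemma load_add_mset [simp]: "load (add_mset S U) x = (if x \<in> objects S then 1 else 0) + load U x"
  by (simp add: load_def)

lemma load_plus [simp]: "load (U + W) x = load U x + load W x"
  by (simp add: load_def)

lemma load_replicate [simp]: "load (replicate_mset n S) x = (if x \<in> objects S then n else 0)"
  by (induction n) auto

lemma load_mono: "U \<subseteq># W \<Longrightarrow> load U x \<le> load W x"
  by (auto simp: subseteq_mset_def load_def intro!: size_mset_mono multiset_filter_mono)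

lemma load_pos_iff: "0 < load U x \<longleftrightarrow> (\<exists>S \<in># U. x \<in> objects S)"
  by (induction U) auto

lemma feasible_mono: "feasible T k W \<Longrightarrow> U \<subseteq># W \<Longrightarrow> feasible T k U"
  unfolding feasible_def using load_mono le_trans by blast

lemma feasible_empty [simp]: "feasible T k {#}"
  by (simp add: feasible_def)

context rooted_tree
begin

text \<open>Each chain from a tip of \<open>S\<close> to its root loses one subtree of \<open>W\<close>: one containing the
  lowest overloaded object of the chain, which then contains all objects above it up to the
  root of \<open>S\<close>.\<close>

lemma greedy_exchange:
  assumes S: "subtree S T"
    and W: "\<And>S'. S' \<in># W \<Longrightarrow> subtree S' T \<and> depth (top_of S') \<le> depth (top_of S)"
    and UW: "feasible T k (U + W)" and US: "feasible T k (add_mset S U)"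
  obtains D where "D \<subseteq># W" "size D \<le> max 1 (leaves T r S)"
    "feasible T k (add_mset S U + (W - D))"
proof -
  define N where "N l = 2 * (depth l - depth (top_of S))" for l
  define bad where "bad x \<longleftrightarrow> x \<in> objects T \<and> k x < load (add_mset S U) x + load W x" for x
  define B where "B = {l \<in> tips S. \<exists>i \<le> N l. bad (chain l i)}"
  define i0 where "i0 l = (LEAST i. i \<le> N l \<and> bad (chain l i))" for l
  have i0: "i0 l \<le> N l" "bad (chain l (i0 l))" if "l \<in> B" for l
  proof -
    have "\<exists>i. i \<le> N l \<and> bad (chain l i)" using that by (auto simp: B_def)
    from LeastI_ex[OF this] show "i0 l \<le> N l" "bad (chain l (i0 l))" by (auto simp: i0_def)
  qed
  have i0_le: "i0 l \<le> i" if "i \<le> N l" "bad (chain l i)" for l i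
    unfolding i0_def using that by (intro Least_le) auto
  have "\<exists>S' \<in># W. chain l (i0 l) \<in> objects S'" if "l \<in> B" for l
  proof -
    have "load (add_mset S U) (chain l (i0 l)) \<le> k (chain l (i0 l))"
      using i0[OF that] US by (auto simp: bad_def feasible_def simp del: load_add_mset)
    then have "0 < load W (chain l (i0 l))"
      using i0[OF that] by (auto simp: bad_def simp del: load_add_mset)
    then show ?thesis by (simp add: load_pos_iff)
  qed
  then obtain f where f: "\<And>l. l \<in> B \<Longrightarrow> f l \<in># W \<and> chain l (i0 l) \<in> objects (f l)"
    by metis
  \<comment> \<open>Several chains may choose the same subtree; one copy of it serves all of them,
    and \<open>mset_set\<close> takes exactly one.\<close>
  define D where "D = mset_set (f ` B)"
  have finB: "finite B" using tips[OF S] by (auto simp: B_def)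
  have DW: "D \<subseteq># W"
    unfolding D_def subseteq_mset_def using f finB
    by (auto simp: count_mset_set' Suc_le_eq)
  moreover have "size D \<le> max 1 (leaves T r S)"
  proof -
    have "size D \<le> card B" using finB by (simp add: D_def card_image_le)
    also have "\<dots> \<le> card (tips S)" using tips[OF S] by (intro card_mono) (auto simp: B_def)
    finally show ?thesis using tips[OF S] by simp
  qed
  moreover have "feasible T k (add_mset S U + (W - D))"
    unfolding feasible_def
  proof
    fix x assume x: "x \<in> objects T"
    have split: "load W x = load (W - D) x + load D x"
      using DW load_plus[of "W - D" D x] by simp
    show "load (add_mset S U + (W - D)) x \<le> k x"
    proof (cases "bad x")
      case False
      then show ?thesis using split x by (simp add: bad_def)
    next
      case True
      \<comment> \<open>\<open>U + W\<close> respects the capacity, so adding \<open>S\<close>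
        exceeds it by exactly one, and removing one subtree that contains \<open>x\<close> repairs
        it.\<close>
      have le: "load U x + load W x \<le> k x" using UW x by (simp add: feasible_def)
      then have "x \<in> objects S" using True by (auto simp: bad_def split: if_splits)
      then obtain l i where li: "l \<in> tips S" "i \<le> N l" "x = chain l i"
        using object_on_chain[OF S] unfolding N_def by blast
      then have lB: "l \<in> B" using True by (auto simp: B_def)
      note fl = f[OF lB]
      have "l \<in> vertices T" using li tips[OF S] S by (auto simp: subtree_def)
      moreover have "i0 l \<le> i" using i0_le li True by simp
      ultimately have "x \<in> objects (f l)"
        using fl W[of "f l"] li chain_mono[of "f l" l "i0 l" i] by (auto simp: N_def)
      then have "0 < load D x"
        using lB finB unfolding load_pos_iff D_def by auto
      then show ?thesis using split le by auto
    qed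
  qed
  ultimately show thesis using that by blast
qed

end

abbreviation greedy_step ::
    "'v graph \<Rightarrow> ('v object \<Rightarrow> nat) \<Rightarrow> 'v graph multiset \<Rightarrow> 'v graph \<Rightarrow> 'v graph multiset" where
  "greedy_step T k U S \<equiv> (if feasible T k (add_mset S U) then add_mset S U else U)"

lemma greedy_sound:
  "feasible T k U \<Longrightarrow> feasible T k (foldl (greedy_step T k) U Ss) \<and>
     U \<subseteq># foldl (greedy_step T k) U Ss \<and> foldl (greedy_step T k) U Ss \<subseteq># U + mset Ss"
proof (induction Ss arbitrary: U)
  case (Cons S Ss)
  let ?U = "greedy_step T k U S"
  have "feasible T k ?U" using Cons.prems by simp
  note IH = Cons.IH[OF this]
  have "U \<subseteq># ?U" "?U + mset Ss \<subseteq># U + mset (S # Ss)" by auto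
  then show ?case using IH by (auto intro: subset_mset.order_trans)
qed simp

text \<open>Ranks are taken in increasing order, hence the complement of the depth. By
  \<open>depth_less_card\<close> the ranks of subtrees lie below the number of vertices, so they can
  be enumerated.\<close>

definition deepest_root_first :: "'v rule" where
  "deepest_root_first T r S = card (vertices T) - Suc (dist T r (root_of T r S))"

context rooted_tree
begin

lemma deepest_root_first_le_iff:
  assumes "subtree S T" "subtree S' T"
  shows "deepest_root_first T r S \<le> deepest_root_first T r S' \<longleftrightarrow>
     depth (top_of S') \<le> depth (top_of S)"
proof -
  have "top_of S \<in> vertices T" "top_of S' \<in> vertices T"
    using top_of(1)[OF assms(1)] top_of(1)[OF assms(2)] assms unfolding subtree_def by blast+
  then show ?thesis
    using depth_less_card[of "top_of S"] depth_less_card[of "top_of S'"]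
    by (auto simp: deepest_root_first_def)
qed

text \<open>The potential \<open>size W + M * size U\<close> never decreases. A rejected
  \<open>S\<close> is not in \<open>W\<close>, since \<open>U + W\<close> is feasible. An accepted
  \<open>S\<close> adds \<open>M\<close>; if it lies in \<open>W\<close> it merely moves to
  \<open>U\<close> at cost 1, and otherwise \<open>greedy_exchange\<close> removes at most
  \<open>M\<close> members of \<open>W\<close>. Once the list is exhausted, \<open>W\<close> is
  empty.\<close>

lemma greedy_ratio:
  assumes "\<And>S. S \<in> set Ss \<Longrightarrow> subtree S T \<and> leaves T r S \<le> M" and "1 \<le> M"
    and "sorted (map (deepest_root_first T r) Ss)"
    and "W \<subseteq># mset Ss" and "feasible T k (U + W)"
  shows "size W + M * size U \<le> M * size (foldl (greedy_step T k) U Ss)"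
  using assms
proof (induction Ss arbitrary: U W)
  case (Cons S Ss)
  show ?case
  proof (cases "feasible T k (add_mset S U)")
    case False
    have "S \<notin># W"
    proof
      assume "S \<in># W"
      then have "add_mset S U \<subseteq># U + W" by (auto simp: insert_subset_eq_iff dest!: multi_member_split)
      then show False using False feasible_mono Cons.prems by blast
    qed
    then have "W \<subseteq># mset Ss"
      using Cons.prems(4) by (metis diff_single_trivial mset.simps(2) subset_eq_diff_conv add_mset_add_single)
    then show ?thesis using Cons False by simp
  next
    case True
    show ?thesis
    proof (cases "S \<in># W")
      case in_W: True
      then obtain W' where W': "W = add_mset S W'" by (meson multi_member_split)
      then have "size W' + M * size (add_mset S U) \<le> M * size (foldl (greedy_step T k) (add_mset S U) Ss)"
        using Cons.prems by (intro Cons.IH) auto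
      then show ?thesis using True W' \<open>1 \<le> M\<close> by simp
    next
      case False
      then have sub: "W \<subseteq># mset Ss"
        using Cons.prems(4) by (metis diff_single_trivial mset.simps(2) subset_eq_diff_conv add_mset_add_single)
      have S: "subtree S T" using Cons.prems by simp
      have W: "subtree S' T \<and> depth (top_of S') \<le> depth (top_of S)" if "S' \<in># W" for S'
      proof -
        have "S' \<in> set Ss" using that sub by (metis mset_subset_eqD set_mset_mset)
        then show ?thesis using Cons.prems deepest_root_first_le_iff[of S S'] by simp
      qed
      obtain D where D: "D \<subseteq># W" "size D \<le> max 1 (leaves T r S)"
          "feasible T k (add_mset S U + (W - D))"
        using greedy_exchange[OF S W _ True] Cons.prems by blast
      have "size (W - D) + M * size (add_mset S U)
          \<le> M * size (foldl (greedy_step T k) (add_mset S U) Ss)"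
        using Cons.prems D(3) subset_mset.order_trans[OF diff_subset_eq_self sub]
        by (intro Cons.IH) auto
      moreover have "size W = size (W - D) + size D"
        using D(1) by (simp add: size_Diff_submset size_mset_mono)
      moreover have "leaves T r S \<le> M" using Cons.prems(1) by simp
      then have "size D \<le> M" using D(2) \<open>1 \<le> M\<close> by simp
      ultimately show ?thesis using True by simp
    qed
  qed
qed simp

end

lemma deepest_root_first_approx:
  assumes inst: "mstbl_instance T \<T> k" and r: "r \<in> vertices T"
    and U: "U \<in> greedy_outputs deepest_root_first T r \<T> k"
  shows "U \<subseteq># \<T>" "feasible T k U"
    "optimal T \<T> k OPT \<Longrightarrow> size OPT \<le> max 1 (max_leaves T r \<T>) * size U"
proof -
  interpret rooted_tree T r
    using inst r by unfold_locales (auto simp: mstbl_instance_def)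
  obtain Ss where Ss: "U = foldl (greedy_step T k) {#} Ss" "mset Ss = \<T>"
      "sorted (map (deepest_root_first T r) Ss)"
    using U by (auto simp: greedy_outputs_def greedy_select_def)
  show "U \<subseteq># \<T>" "feasible T k U" using greedy_sound[of T k "{#}" Ss] Ss by auto
  have "subtree S T \<and> leaves T r S \<le> max 1 (max_leaves T r \<T>)" if "S \<in> set Ss" for S
  proof -
    have "S \<in># \<T>" using that Ss by auto
    then have "leaves T r S \<le> max_leaves T r \<T>"
      unfolding max_leaves_def by (intro Max_ge) auto
    then show ?thesis using inst \<open>S \<in># \<T>\<close> by (auto simp: mstbl_instance_def)
  qed
  then show "size OPT \<le> max 1 (max_leaves T r \<T>) * size U" if "optimal T \<T> k OPT"
    using greedy_ratio[of Ss "max 1 (max_leaves T r \<T>)" OPT k "{#}"] that Ss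
    by (auto simp: optimal_def)
qed

section \<open>Unit-cost execution and the logarithmic cost criterion\<close>

inductive steps :: "prog \<Rightarrow> store \<Rightarrow> nat \<Rightarrow> store \<Rightarrow> bool" where
  steps_Skip: "steps Skip s 1 s"
| steps_Assign: "steps (Assign x a e) s 1 (s(x := (s x)(val s a := val s e)))"
| steps_Seq: "steps p s m s' \<Longrightarrow> steps q s' n s'' \<Longrightarrow> steps (Seq p q) s (m + n) s''"
| steps_If_true: "val s e \<noteq> 0 \<Longrightarrow> steps p s n s' \<Longrightarrow> steps (If e p q) s (Suc n) s'"
| steps_If_false: "val s e = 0 \<Longrightarrow> steps q s n s' \<Longrightarrow> steps (If e p q) s (Suc n) s'"
| steps_While_false: "val s e = 0 \<Longrightarrow> steps (While e p) s 1 s"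
| steps_While_true: "val s e \<noteq> 0 \<Longrightarrow> steps p s m s' \<Longrightarrow> steps (While e p) s' n s'' \<Longrightarrow>
    steps (While e p) s (Suc (m + n)) s''"

text \<open>Assigning only \<open>tame\<close> expressions lets the largest stored number grow by at most a bounded
  multiple of the largest input number per step, so that all bit lengths stay polynomial.\<close>

fun input_exp :: "exp \<Rightarrow> bool" where
  "input_exp (Num n) = True"
| "input_exp (Cell x a) = (x = ''in'')"
| "input_exp (Add a b) = (input_exp a \<and> input_exp b)"
| "input_exp (Monus a b) = input_exp a"

fun tame :: "exp \<Rightarrow> bool" where
  "tame (Num n) = True"
| "tame (Cell x a) = True"
| "tame (Add a b) = (tame a \<and> input_exp b)"
| "tame (Monus a b) = tame a"

fun tame_prog :: "prog \<Rightarrow> bool" where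
  "tame_prog Skip = True"
| "tame_prog (Assign x a e) = (x \<noteq> ''in'' \<and> tame e)"
| "tame_prog (Seq p q) = (tame_prog p \<and> tame_prog q)"
| "tame_prog (If e p q) = (tame_prog p \<and> tame_prog q)"
| "tame_prog (While e p) = tame_prog p"

text \<open>Constants are weighted by their value, so that \<open>esize e\<close> also bounds the
  factor by which the value of \<open>e\<close> can exceed the stored numbers.\<close>

fun esize :: "exp \<Rightarrow> nat" where
  "esize (Num n) = Suc n"
| "esize (Cell x a) = Suc (esize a)"
| "esize (Add a b) = Suc (esize a + esize b)"
| "esize (Monus a b) = Suc (esize a + esize b)"

fun psize :: "prog \<Rightarrow> nat" where
  "psize Skip = 0"
| "psize (Assign x a e) = esize a + esize e"
| "psize (Seq p q) = psize p + psize q"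
| "psize (If e p q) = esize e + psize p + psize q"
| "psize (While e p) = esize e + psize p"

lemma bits_mono: "m \<le> n \<Longrightarrow> bits m \<le> bits n"
  by (simp add: bits_def floor_log_le_iff)

lemma val_le:
  assumes "\<forall>x i. s x i \<le> M"
  shows "val s e \<le> esize e * Suc M"
proof (induction e)
  case (Cell x a)
  have "s x (val s a) \<le> M" using assms by blast
  then show ?case by simp
qed (auto simp: add_mult_distrib)

lemma val_input_le:
  assumes "\<forall>i. s ''in'' i \<le> B" "input_exp e"
  shows "val s e \<le> esize e * Suc B"
  using assms(2)
proof (induction e)
  case (Cell x a)
  have "s ''in'' (val s a) \<le> B" using assms by blast
  then show ?case using Cell by simp
qed (auto simp: add_mult_distrib)

lemma val_tame_le:
  assumes "\<forall>i. s ''in'' i \<le> B" "\<forall>x i. s x i \<le> M" "tame e"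
  shows "val s e \<le> M + esize e * Suc B"
  using assms(3)
proof (induction e)
  case (Cell x a)
  have "s x (val s a) \<le> M" using assms by blast
  then show ?case by simp
next
  case (Add a b)
  then have "val s a \<le> M + esize a * Suc B" by simp
  moreover have "val s b \<le> esize b * Suc B" using Add val_input_le[of s B b] assms(1) by simp
  ultimately show ?case by (simp add: add_mult_distrib)
next
  case (Monus a b)
  then have "val s a \<le> M + esize a * Suc B" by simp
  then show ?case by (simp add: add_mult_distrib)
qed simp

text \<open>Every subexpression has size at most \<open>K\<close>, hence a value of at most
  \<open>K * Suc M\<close>, and there are at most \<open>esize e\<close> operations to
  charge.\<close>

lemma cost_le:
  assumes s: "\<forall>x i. s x i \<le> M" and "esize e \<le> K"
  shows "cost s e \<le> esize e * bits (K * Suc M)"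
proof -
  have *: "bits (val s e') \<le> bits (K * Suc M)" if "esize e' \<le> K" for e'
    using val_le[OF s, of e'] that by (meson bits_mono le_trans mult_le_mono1)
  show ?thesis
    using assms(2)
  proof (induction e)
    case (Num n)
    then show ?case using *[of "Num n"] by simp
  next
    case (Cell x a)
    then show ?case using *[of "Cell x a"] by simp
  next
    case (Add a b)
    then show ?case using *[of "Add a b"] by (simp add: add_mult_distrib)
  next
    case (Monus a b)
    then show ?case using *[of "Monus a b"] by (simp add: add_mult_distrib)
  qed
qed

text \<open>\<open>M\<close> bounds the current store and grows by at most \<open>K * Suc B\<close>
  per step, while \<open>Z\<close> is a fixed bound for the whole run, so that every step can be
  charged the same amount \<open>L\<close>. The bound \<open>B\<close> persists because tame
  programs never write to the input array.\<close>

lemma steps_exec_aux: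
  fixes K B Z :: nat
  defines "L \<equiv> Suc (K * bits (K * Suc Z))"
  assumes "steps p s n s'" and "tame_prog p" and "psize p \<le> K"
    and "\<forall>i. s ''in'' i \<le> B" and "\<forall>x i. s x i \<le> M" and "M + n * (K * Suc B) \<le> Z"
  shows "\<exists>t. exec p s t s' \<and> t \<le> n * L \<and> (\<forall>i. s' ''in'' i \<le> B) \<and>
    (\<forall>x i. s' x i \<le> M + n * (K * Suc B))"
  using assms(2-)
proof (induction arbitrary: M rule: steps.induct)
  case (steps_Skip s)
  then show ?case using exec_Skip[of s]
    by (intro exI[of _ 1]) (auto simp: L_def intro: trans_le_add1)
next
  case (steps_Assign x a e s)
  have s: "\<forall>x i. s x i \<le> Z" using steps_Assign.prems(4,5) by (meson le_add1 le_trans)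
  have "cost s a + cost s e \<le> (esize a + esize e) * bits (K * Suc Z)"
    using cost_le[OF s, of a K] cost_le[OF s, of e K] steps_Assign.prems(2)
    by (simp add: add_mult_distrib)
  also have "\<dots> \<le> K * bits (K * Suc Z)" using steps_Assign.prems(2) by simp
  finally have t: "Suc (cost s a + cost s e) \<le> 1 * L" by (simp add: L_def)
  have "val s e \<le> M + esize e * Suc B"
    using steps_Assign.prems by (intro val_tame_le) auto
  also have "\<dots> \<le> M + K * Suc B" using steps_Assign.prems(2) by (intro add_mono mult_le_mono1) auto
  finally have "val s e \<le> M + 1 * (K * Suc B)" by simp
  moreover have "s y i \<le> M + 1 * (K * Suc B)" for y i
    using steps_Assign.prems(4) by (meson le_add1 le_trans)
  ultimately have "\<forall>y i. (s(x := (s x)(val s a := val s e))) y i \<le> M + 1 * (K * Suc B)"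
    by (auto simp del: mult_Suc_right One_nat_def)
  moreover have "\<forall>i. (s(x := (s x)(val s a := val s e))) ''in'' i \<le> B"
    using steps_Assign.prems(1,3) by auto
  ultimately show ?case using t exec_Assign by blast
next
  case (steps_Seq p s m s' q n s'')
  have 1: "M + m * (K * Suc B) \<le> Z" using steps_Seq.prems(5) by (simp add: add_mult_distrib)
  obtain t where t: "exec p s t s'" "t \<le> m * L" "\<forall>i. s' ''in'' i \<le> B"
      "\<forall>x i. s' x i \<le> M + m * (K * Suc B)"
    using steps_Seq.IH(1)[OF _ _ steps_Seq.prems(3,4) 1] steps_Seq.prems(1,2) by auto
  have 2: "M + m * (K * Suc B) + n * (K * Suc B) \<le> Z"
    using steps_Seq.prems(5) by (simp only: add_mult_distrib add.assoc)
  obtain u where "exec q s' u s''" "u \<le> n * L" "\<forall>i. s'' ''in'' i \<le> B"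
      "\<forall>x i. s'' x i \<le> M + m * (K * Suc B) + n * (K * Suc B)"
    using steps_Seq.IH(2)[OF _ _ t(3,4) 2] steps_Seq.prems(1,2) by auto
  then show ?case using t exec_Seq[of p s t s' q u s'']
    by (intro exI[of _ "t + u"]) (simp add: add_mult_distrib add.assoc)
next
  case (steps_If_true s e p n s' q)
  have s: "\<forall>x i. s x i \<le> Z" using steps_If_true.prems(4,5) by (meson le_add1 le_trans)
  have "cost s e \<le> esize e * bits (K * Suc Z)"
    using steps_If_true.prems(2) by (intro cost_le[OF s]) simp
  also have "\<dots> \<le> K * bits (K * Suc Z)" using steps_If_true.prems(2) by (intro mult_le_mono1) simp
  finally have c: "Suc (cost s e) \<le> L" by (simp add: L_def)
  have 1: "M + n * (K * Suc B) \<le> Z" using steps_If_true.prems(5) by (simp add: add_mult_distrib)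
  obtain t where t: "exec p s t s'" "t \<le> n * L" "\<forall>i. s' ''in'' i \<le> B"
      "\<forall>x i. s' x i \<le> M + n * (K * Suc B)"
    using steps_If_true.IH[OF _ _ steps_If_true.prems(3,4) 1] steps_If_true.prems(1,2) by auto
  have "s' x i \<le> M + Suc n * (K * Suc B)" for x i
    using t(4)[rule_format, of x i] unfolding mult_Suc[of n] by linarith
  then show ?case using exec_If_true[OF steps_If_true.hyps(1) t(1), of q] t c
    by (intro exI[of _ "Suc (cost s e + t)"]) (simp del: mult_Suc_right)
next
  case (steps_If_false s e q n s' p)
  have s: "\<forall>x i. s x i \<le> Z" using steps_If_false.prems(4,5) by (meson le_add1 le_trans)
  have "cost s e \<le> esize e * bits (K * Suc Z)"
    using steps_If_false.prems(2) by (intro cost_le[OF s]) simp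
  also have "\<dots> \<le> K * bits (K * Suc Z)" using steps_If_false.prems(2) by (intro mult_le_mono1) simp
  finally have c: "Suc (cost s e) \<le> L" by (simp add: L_def)
  have 1: "M + n * (K * Suc B) \<le> Z" using steps_If_false.prems(5) by (simp add: add_mult_distrib)
  obtain t where t: "exec q s t s'" "t \<le> n * L" "\<forall>i. s' ''in'' i \<le> B"
      "\<forall>x i. s' x i \<le> M + n * (K * Suc B)"
    using steps_If_false.IH[OF _ _ steps_If_false.prems(3,4) 1] steps_If_false.prems(1,2) by auto
  have "s' x i \<le> M + Suc n * (K * Suc B)" for x i
    using t(4)[rule_format, of x i] unfolding mult_Suc[of n] by linarith
  then show ?case using exec_If_false[OF steps_If_false.hyps(1) t(1), of p] t c
    by (intro exI[of _ "Suc (cost s e + t)"]) (simp del: mult_Suc_right)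
next
  case (steps_While_false s e p)
  have s: "\<forall>x i. s x i \<le> Z" using steps_While_false.prems(4,5) by (meson le_add1 le_trans)
  have "cost s e \<le> esize e * bits (K * Suc Z)"
    using steps_While_false.prems(2) by (intro cost_le[OF s]) simp
  also have "\<dots> \<le> K * bits (K * Suc Z)" using steps_While_false.prems(2) by (intro mult_le_mono1) simp
  finally have c: "Suc (cost s e) \<le> 1 * L" by (simp add: L_def)
  have "s x i \<le> M + 1 * (K * Suc B)" for x i
    using steps_While_false.prems(4) by (meson le_add1 le_trans)
  then show ?case using c exec_While_false[OF steps_While_false.hyps(1)] steps_While_false.prems(3)
    by blast
next
  case (steps_While_true s e p m s' n s'')
  have s: "\<forall>x i. s x i \<le> Z" using steps_While_true.prems(4,5) by (meson le_add1 le_trans)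
  have "cost s e \<le> esize e * bits (K * Suc Z)"
    using steps_While_true.prems(2) by (intro cost_le[OF s]) simp
  also have "\<dots> \<le> K * bits (K * Suc Z)" using steps_While_true.prems(2) by (intro mult_le_mono1) simp
  finally have c: "Suc (cost s e) \<le> L" by (simp add: L_def)
  have 1: "M + m * (K * Suc B) \<le> Z" using steps_While_true.prems(5) by (simp add: add_mult_distrib)
  obtain t where t: "exec p s t s'" "t \<le> m * L" "\<forall>i. s' ''in'' i \<le> B"
      "\<forall>x i. s' x i \<le> M + m * (K * Suc B)"
    using steps_While_true.IH(1)[OF _ _ steps_While_true.prems(3,4) 1] steps_While_true.prems(1,2)
    by auto
  have 2: "M + m * (K * Suc B) + n * (K * Suc B) \<le> Z"
    using steps_While_true.prems(5) by (simp only: add_mult_distrib mult_Suc)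
  obtain u where u: "exec (While e p) s' u s''" "u \<le> n * L" "\<forall>i. s'' ''in'' i \<le> B"
      "\<forall>x i. s'' x i \<le> M + m * (K * Suc B) + n * (K * Suc B)"
    using steps_While_true.IH(2)[OF steps_While_true.prems(1,2) t(3,4) 2] by auto
  have "s'' x i \<le> M + Suc (m + n) * (K * Suc B)" for x i
    using u(4)[rule_format, of x i] by (simp only: add_mult_distrib mult_Suc)
  then show ?case
    using exec_While_true[OF steps_While_true.hyps(1) t(1) u(1)] t(2) u(2,3) c
    by (intro exI[of _ "Suc (cost s e + t + u)"]) (simp add: add_mult_distrib del: mult_Suc_right)
qed

text \<open>Stored numbers will be at most \<open>2 ^ N\<close> times a value \<open>m\<close> of a
  polynomial, so the crude bound \<open>Suc m\<close> for the bits of \<open>m\<close> is still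
  polynomial.\<close>

lemma bits_mult_power2: "bits (2 ^ n * m) \<le> n + Suc m"
proof (cases "m = 0")
  case False
  then have "floor_log (2 ^ n * m) = n + floor_log m"
    by (induction n) (simp_all add: mult.assoc floor_log_twice)
  moreover have "floor_log m \<le> m"
    using floor_log_exp2_le[of m] less_exp[of "floor_log m"] False by linarith
  ultimately show ?thesis by (simp add: bits_def)
qed (simp add: bits_def)

lemma less_power_bits: "n < 2 ^ bits n"
  using floor_log_exp2_gt[of n] by (cases "n = 0") (auto simp: bits_def)

lemma length_le_input_size: "length xs \<le> input_size xs"
  by (induction xs) (auto simp: input_size_def bits_def)

lemma input_store_le: "input_store xs x i \<le> 2 ^ input_size xs"
proof -
  have "n \<le> 2 ^ input_size xs" if "n \<in> set xs" for n
  proof -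
    have "bits n \<le> input_size xs"
      using that unfolding input_size_def by (intro member_le_sum_list) auto
    then have "(2::nat) ^ bits n \<le> 2 ^ input_size xs" by (rule power_increasing) simp
    with less_power_bits[of n] show ?thesis by linarith
  qed
  moreover have "length xs \<le> 2 ^ input_size xs"
    using length_le_input_size[of xs] less_exp[of "input_size xs"] by linarith
  ultimately show ?thesis by (auto simp: input_store_def)
qed

lemma tame_polynomial_time:
  fixes q :: "nat poly"
  assumes "tame_prog p"
  shows "\<exists>b :: nat poly. \<forall>xs n s. steps p (input_store xs) n s \<and> n \<le> poly q (input_size xs) \<longrightarrow>
    (\<exists>t. exec p (input_store xs) t s \<and> t \<le> poly b (input_size xs))"
proof -
  define K where "K = psize p"
  \<comment> \<open>With \<open>B = 2 ^ N\<close>, at most \<open>q(N)\<close> steps give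
    \<open>Suc Z \<le> B * (2 + 2 * K * q(N))\<close>; \<open>Y\<close> is \<open>K\<close> times
    the second factor. \<open>b\<close> is then the number of steps times the bound
    \<open>1 + K * (N + 1 + Y(N))\<close> on the cost of a step.\<close>
  define Y :: "nat poly" where "Y = [:K:] * ([:2:] + q * [:2 * K:])"
  define b where "b = q * ([:1:] + [:K:] * ([:1, 1:] + Y))"
  have "\<exists>t. exec p (input_store xs) t s \<and> t \<le> poly b (input_size xs)"
    if st: "steps p (input_store xs) n s" and n: "n \<le> poly q (input_size xs)" for xs n s
  proof -
    let ?N = "input_size xs"
    define B :: nat where "B = 2 ^ ?N"
    define Z where "Z = B + n * (K * Suc B)"
    obtain t where t: "exec p (input_store xs) t s" "t \<le> n * Suc (K * bits (K * Suc Z))"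
      using steps_exec_aux[OF st assms, of K B B Z] input_store_le[of xs]
      by (auto simp: K_def B_def Z_def)
    have B1: "1 \<le> B" by (simp add: B_def)
    then have "Suc B \<le> 2 * B" by simp
    have "Z \<le> B + n * (K * (2 * B))"
      unfolding Z_def using \<open>Suc B \<le> 2 * B\<close> by (intro add_left_mono mult_le_mono2)
    also have "\<dots> = B * (1 + n * (2 * K))" by (simp add: algebra_simps)
    finally have "Suc Z \<le> B * (1 + n * (2 * K)) + B" using B1 by linarith
    also have "\<dots> = B * (2 + n * (2 * K))" by (simp add: algebra_simps)
    also have "\<dots> \<le> B * (2 + poly q ?N * (2 * K))" using n by (intro mult_le_mono2 add_left_mono mult_le_mono1)
    finally have "K * Suc Z \<le> K * (B * (2 + poly q ?N * (2 * K)))" by (rule mult_le_mono2)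
    also have "\<dots> = B * (K * (2 + poly q ?N * (2 * K)))" by (rule mult.left_commute)
    also have "\<dots> = 2 ^ ?N * poly Y ?N" by (simp add: Y_def B_def mult_ac)
    finally have "bits (K * Suc Z) \<le> ?N + Suc (poly Y ?N)"
      using bits_mono bits_mult_power2 le_trans by blast
    then have "n * Suc (K * bits (K * Suc Z)) \<le> poly q ?N * Suc (K * (?N + Suc (poly Y ?N)))"
      using n by (intro mult_le_mono Suc_le_mono[THEN iffD2]) auto
    also have "\<dots> = poly b ?N" by (simp add: b_def algebra_simps)
    finally show ?thesis using t by (meson le_trans)
  qed
  then show ?thesis by blast
qed


section \<open>Hoare logic with step bounds\<close>

definition hoare :: "(store \<Rightarrow> bool) \<Rightarrow> prog \<Rightarrow> nat \<Rightarrow> (store \<Rightarrow> bool) \<Rightarrow> bool" where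
  "hoare P p n Q \<longleftrightarrow> (\<forall>s. P s \<longrightarrow> (\<exists>m s'. steps p s m s' \<and> m \<le> n \<and> Q s'))"

lemma hoareD: "hoare P p n Q \<Longrightarrow> P s \<Longrightarrow> \<exists>m s'. steps p s m s' \<and> m \<le> n \<and> Q s'"
  by (auto simp: hoare_def)

lemma hoareI: "(\<And>s. P s \<Longrightarrow> \<exists>m s'. steps p s m s' \<and> m \<le> n \<and> Q s') \<Longrightarrow> hoare P p n Q"
  by (simp add: hoare_def)

lemma hoare_conseq:
  assumes "hoare P p n Q" "\<And>s. P' s \<Longrightarrow> P s" "\<And>s. Q s \<Longrightarrow> Q' s" "n \<le> n'"
  shows "hoare P' p n' Q'"
proof (rule hoareI)
  fix s assume "P' s"
  then show "\<exists>m s'. steps p s m s' \<and> m \<le> n' \<and> Q' s'"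
    using hoareD[OF assms(1) assms(2)] assms(3,4) le_trans by blast
qed

lemma hoare_Skip: "(\<And>s. P s \<Longrightarrow> Q s) \<Longrightarrow> 1 \<le> n \<Longrightarrow> hoare P Skip n Q"
  using steps_Skip by (intro hoareI) blast

lemma hoare_Assign:
  "(\<And>s. P s \<Longrightarrow> Q (s(x := (s x)(val s a := val s e)))) \<Longrightarrow> 1 \<le> n \<Longrightarrow> hoare P (Assign x a e) n Q"
  using steps_Assign by (intro hoareI) blast

text \<open>Address and value are replaced by their meaning in the old store before the
  postcondition is checked, so large expressions are not unfolded in the updated store.\<close>

lemma hoare_Assign_val:
  assumes "\<And>s. P s \<Longrightarrow> val s a = A s" "\<And>s. P s \<Longrightarrow> val s e = E s"
    and "\<And>s. P s \<Longrightarrow> Q (s(x := (s x)(A s := E s)))" "1 \<le> n"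
  shows "hoare P (Assign x a e) n Q"
  using assms by (intro hoare_Assign) simp_all

lemma hoare_Seq:
  assumes "hoare P p m R" "hoare R q n Q" "m + n \<le> l"
  shows "hoare P (Seq p q) l Q"
proof (rule hoareI)
  fix s assume "P s"
  then obtain i s' where "steps p s i s'" "i \<le> m" "R s'" using hoareD[OF assms(1)] by blast
  moreover from this obtain j s'' where "steps q s' j s''" "j \<le> n" "Q s''"
    using hoareD[OF assms(2)] by blast
  ultimately show "\<exists>m s'. steps (Seq p q) s m s' \<and> m \<le> l \<and> Q s'"
    using steps_Seq[of p s i s' q j s''] assms(3) by (intro exI[of _ "i + j"] exI[of _ s'']) simp
qed

lemma hoare_If:
  assumes "hoare (\<lambda>s. P s \<and> val s e \<noteq> 0) p n Q" "hoare (\<lambda>s. P s \<and> val s e = 0) q n Q"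
    "Suc n \<le> m"
  shows "hoare P (If e p q) m Q"
proof (rule hoareI)
  fix s assume "P s"
  show "\<exists>m' s'. steps (If e p q) s m' s' \<and> m' \<le> m \<and> Q s'"
  proof (cases "val s e = 0")
    case True
    then obtain i s' where "steps q s i s'" "i \<le> n" "Q s'"
      using hoareD[OF assms(2), of s] \<open>P s\<close> by auto
    then show ?thesis using steps_If_false[OF True, of q i s'] assms(3)
      by (intro exI[of _ "Suc i"] exI[of _ s']) simp
  next
    case False
    then obtain i s' where "steps p s i s'" "i \<le> n" "Q s'"
      using hoareD[OF assms(1), of s] \<open>P s\<close> by auto
    then show ?thesis using steps_If_true[OF False, of p i s'] assms(3)
      by (intro exI[of _ "Suc i"] exI[of _ s']) simp
  qed
qed

definition For :: "string \<Rightarrow> exp \<Rightarrow> prog \<Rightarrow> prog" where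
  "For x e p = Seq (Assign x (Num 0) (Num 0))
     (While (Monus e (Cell x (Num 0))) (Seq p (Assign x (Num 0) (Add (Cell x (Num 0)) (Num 1)))))"

text \<open>The invariant is indexed by the counter and must not depend on the counter cell. Each
  round pays 2 on top of the body, for the guard and the increment; the other 2 are the initial
  assignment and the failing guard.\<close>

lemma hoare_For:
  assumes body: "\<And>i. i < N \<Longrightarrow> hoare (\<lambda>s. I i s \<and> s x 0 = i) p n (\<lambda>s. I (Suc i) s \<and> s x 0 = i)"
    and counter: "\<And>i v s. I i s \<Longrightarrow> I i (s(x := (s x)(0 := v)))"
    and guard: "\<And>i s. I i s \<Longrightarrow> val s e = N"
    and init: "\<And>s. P s \<Longrightarrow> I 0 s" and final: "\<And>s. I N s \<Longrightarrow> Q s"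
    and bound: "2 + N * (n + 2) \<le> m"
  shows "hoare P (For x e p) m Q"
proof -
  define q where "q = Seq p (Assign x (Num 0) (Add (Cell x (Num 0)) (Num 1)))"
  have q: "hoare (\<lambda>s. I i s \<and> s x 0 = i) q (n + 1) (\<lambda>s. I (Suc i) s \<and> s x 0 = Suc i)" if "i < N" for i
    unfolding q_def by (rule hoare_Seq[OF body[OF that] hoare_Assign order_refl]) (auto simp: counter)
  have "\<exists>l s'. steps (While (Monus e (Cell x (Num 0))) q) s l s' \<and> l \<le> Suc (d * (n + 2)) \<and> Q s'"
    if "I i s" "s x 0 = i" "i + d = N" for d i s
    using that
  proof (induction d arbitrary: i s)
    case 0
    then have "val s (Monus e (Cell x (Num 0))) = 0" "Q s" using guard[of i s] final by auto
    from steps_While_false[OF this(1), of q] this(2) show ?case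
      by (intro exI[of _ 1] exI[of _ s]) auto
  next
    case (Suc d)
    obtain k s' where s': "steps q s k s'" "k \<le> n + 1" "I (Suc i) s'" "s' x 0 = Suc i"
      using hoareD[OF q[of i], of s] Suc.prems by auto
    obtain l s'' where s'': "steps (While (Monus e (Cell x (Num 0))) q) s' l s''"
        "l \<le> Suc (d * (n + 2))" "Q s''"
      using Suc.IH[OF s'(3,4)] Suc.prems by auto
    have "val s (Monus e (Cell x (Num 0))) \<noteq> 0" using Suc.prems guard[of i s] by simp
    from steps_While_true[OF this s'(1) s''(1)] show ?case using s' s''
      by (intro exI[of _ "Suc (k + l)"] exI[of _ s'']) simp
  qed
  from this[of 0 _ N]
  have "hoare (\<lambda>s. I 0 s \<and> s x 0 = 0) (While (Monus e (Cell x (Num 0))) q) (Suc (N * (n + 2))) Q"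
    by (intro hoareI) simp
  moreover have "hoare P (Assign x (Num 0) (Num 0)) 1 (\<lambda>s. I 0 s \<and> s x 0 = 0)"
    by (rule hoare_Assign) (auto simp: counter init)
  ultimately show ?thesis
    unfolding For_def q_def[symmetric] using bound
    by (intro hoare_Seq[of P _ 1 "\<lambda>s. I 0 s \<and> s x 0 = 0" _ "Suc (N * (n + 2))"]) auto
qed

section \<open>The program\<close>

abbreviation Var :: "string \<Rightarrow> exp" where "Var x \<equiv> Cell x (Num 0)"
abbreviation In :: "exp \<Rightarrow> exp" where "In a \<equiv> Cell ''in'' a"

text \<open>In the array \<open>d\<close>, 0 marks an unreached vertex, and a reached vertex has its depth plus 1.\<close>

definition relax :: "exp \<Rightarrow> exp \<Rightarrow> prog" where
  "relax a b = If (Monus (Num 1) (Cell ''d'' b))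
     (If (Cell ''d'' a) (Assign ''d'' b (Add (Cell ''d'' a) (Num 1))) Skip) Skip"

text \<open>Cell 0 of the input array is the length and cells 1 to 4 are the header, so the edges
  start at cell 5 with two cells each; doubling is done by addition.\<close>

abbreviation edge_src :: exp where
  "edge_src \<equiv> In (Add (Num 5) (Add (Var ''i'') (Var ''i'')))"
abbreviation edge_tgt :: exp where
  "edge_tgt \<equiv> In (Add (Num 6) (Add (Var ''i'') (Var ''i'')))"

text \<open>Rounds over all edges in both directions, as in the Bellman-Ford algorithm. In a tree a
  vertex receives its true depth when first reached, so only unset cells are written; one round per
  vertex suffices, as depths are smaller than the number of vertices.\<close>

definition depths_prog :: prog where
  "depths_prog = Seq (Assign ''d'' (In (Num 4)) (Num 1))
     (For ''y'' (In (Num 1)) (For ''i'' (In (Num 2))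
       (Seq (relax edge_src edge_tgt) (relax edge_tgt edge_src))))"

text \<open>For the \<open>j\<close>-th listed subtree, \<open>b\<close> holds the address of its entry and \<open>h\<close> the depth of its
  root plus 1.  Here and below, \<open>a - (a - b)\<close> is the minimum of \<open>a\<close> and \<open>b\<close>.\<close>

definition scan_entry :: prog where
  "scan_entry =
     Seq (Assign ''b'' (Var ''j'') (Var ''p''))
    (Seq (Assign ''h'' (Var ''j'') (Add (In (Num 1)) (Num 1)))
    (Seq (For ''i'' (In (Add (Var ''p'') (Num 1)))
           (Assign ''h'' (Var ''j'') (Monus (Cell ''h'' (Var ''j'')) (Monus (Cell ''h'' (Var ''j''))
              (Cell ''d'' (In (Add (Var ''p'') (Add (Num 3) (Var ''i'')))))))))
         (Assign ''p'' (Num 0) (Add (Var ''p'') (Add (Num 3)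
            (Add (In (Add (Var ''p'') (Num 1))) (In (Add (Var ''p'') (Num 2)))))))))"

text \<open>With \<open>n\<close> vertices and \<open>m\<close> edges, the length, 4 header cells,
  \<open>2 * m\<close> edge cells and \<open>n + m\<close> capacities precede the first entry, which
  therefore starts at cell \<open>5 + 3 * m + n\<close>.\<close>

definition scan_prog :: prog where
  "scan_prog = Seq
     (Assign ''p'' (Num 0) (Add (Num 5) (Add (In (Num 2)) (Add (In (Num 2)) (Add (In (Num 2)) (In (Num 1)))))))
     (For ''j'' (In (Num 3)) scan_entry)"

abbreviation entry :: "exp \<Rightarrow> exp" where
  "entry e \<equiv> In (Add (Cell ''b'' (Var ''j'')) e)"

text \<open>Objects are numbered with the vertices first.  As \<open>g\<close> contains 0 and then the number of
  vertices, its cell \<open>1 - (v - i)\<close> is the offset of the \<open>i\<close>-th object of an entry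
  with \<open>v\<close> vertices.\<close>

abbreviation obj_exp :: exp where
  "obj_exp \<equiv> Add (entry (Add (Num 3) (Var ''i'')))
     (Cell ''g'' (Monus (Num 1) (Monus (entry (Num 1)) (Var ''i''))))"
abbreviation cap_exp :: exp where
  "cap_exp \<equiv> In (Add (Num 5) (Add (In (Num 2)) (Add (In (Num 2)) obj_exp)))"
abbreviation resid_exp :: exp where
  "resid_exp \<equiv> Monus cap_exp (Cell ''l'' obj_exp)"
abbreviation objs_exp :: exp where
  "objs_exp \<equiv> Add (entry (Num 1)) (entry (Num 2))"

text \<open>The load \<open>l\<close> is updated to \<open>cap - ((cap - l) - x)\<close>, which equals \<open>l + x\<close> as
  \<open>l + x \<le> cap\<close>, because this expression is tame.\<close>

definition select_prog :: prog where
  "select_prog =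
     Seq (Assign ''x'' (Num 0) (entry (Num 0)))
    (Seq (For ''i'' objs_exp
           (Assign ''x'' (Num 0) (Monus (Var ''x'') (Monus (Var ''x'') resid_exp))))
    (Seq (For ''i'' objs_exp (Assign ''l'' obj_exp (Monus cap_exp (Monus resid_exp (Var ''x'')))))
         (Assign ''out'' (Var ''j'') (Var ''x''))))"

text \<open>The absolute value of \<open>h + y - n\<close> from two truncated differences. As
  \<open>h\<close> is the root depth plus 1, it vanishes exactly when the subtree has rank
  \<open>y\<close>.\<close>

abbreviation level_exp :: exp where
  "level_exp \<equiv> Add (Monus (Add (Cell ''h'' (Var ''j'')) (Var ''y'')) (In (Num 1)))
     (Monus (In (Num 1)) (Add (Cell ''h'' (Var ''j'')) (Var ''y'')))"

definition main_prog :: prog where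
  "main_prog = For ''y'' (In (Num 1)) (For ''j'' (In (Num 3)) (If level_exp Skip select_prog))"

definition greedy_prog :: prog where
  "greedy_prog = Seq (Assign ''g'' (Num 1) (In (Num 1))) (Seq depths_prog (Seq scan_prog main_prog))"

lemma tame_greedy_prog: "tame_prog greedy_prog"
  by (simp add: greedy_prog_def main_prog_def select_prog_def scan_prog_def scan_entry_def
      depths_prog_def relax_def For_def)


section \<open>Input layout\<close>

lemma input_store_append:
  "i < length ys \<Longrightarrow> input_store (xs @ ys @ zs) ''in'' (Suc (length xs + i)) = ys ! i"
  by (simp add: input_store_def nth_append)

lemma nth_concat:
  assumes "j < length xss" "i < length (xss ! j)"
  shows "concat xss ! ((\<Sum>j'<j. length (xss ! j')) + i) = xss ! j ! i"
  using assms
proof (induction xss arbitrary: j)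
  case (Cons xs xss)
  then show ?case by (cases j) (auto simp: nth_append sum.lessThan_Suc_shift add.assoc simp del: sum.lessThan_Suc)
qed simp

lemma length_concat_nth: "length (concat xss) = (\<Sum>j<length xss. length (xss ! j))"
  by (simp add: length_concat sum_list_sum_nth atLeast0LessThan)

lemma nth_concat_less:
  assumes "j < length xss" "i < length (xss ! j)"
  shows "(\<Sum>j'<j. length (xss ! j')) + i < length (concat xss)"
proof -
  have "(\<Sum>j'<j. length (xss ! j')) + i < (\<Sum>j'<Suc j. length (xss ! j'))" using assms by simp
  also have "\<dots> \<le> (\<Sum>j<length xss. length (xss ! j))"
    using assms by (intro sum_mono2) auto
  finally show ?thesis by (simp only: length_concat_nth)
qed

lemma foldl_greedy_reject:
  "\<not> feasible T k (add_mset S U) \<Longrightarrow> foldl (greedy_step T k) U (replicate n S) = U"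
  by (induction n) auto

text \<open>Feasibility is inherited by sub-multisets, so all acceptances among equal copies come
  first and one rejection settles the rest. This replaces a run over exponentially many copies by a
  single number \<open>x\<close>.\<close>

lemma foldl_greedy_replicate:
  assumes "feasible T k (U + replicate_mset x S)" "x \<le> n"
    and "x < n \<Longrightarrow> \<not> feasible T k (U + replicate_mset (Suc x) S)"
  shows "foldl (greedy_step T k) U (replicate n S) = U + replicate_mset x S"
  using assms
proof (induction x arbitrary: U n)
  case 0
  then show ?case by (cases n) (auto simp: foldl_greedy_reject)
next
  case (Suc x)
  then obtain n' where n: "n = Suc n'" by (cases n) auto
  have "feasible T k (add_mset S U)"
    using Suc.prems(1) by (rule feasible_mono) simp
  moreover have "foldl (greedy_step T k) (add_mset S U) (replicate n' S)
      = add_mset S U + replicate_mset x S"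
    using Suc.prems n by (intro Suc.IH) auto
  ultimately show ?case using n by simp
qed

section \<open>An encoded instance and the position of its data in the input array\<close>

locale encoded_instance =
  fixes c :: instance_code and T :: "nat graph" and r :: nat
    and \<T> :: "nat graph multiset" and k :: "nat object \<Rightarrow> nat"
  assumes inst: "mstbl_instance T \<T> k" and root_in: "r \<in> vertices T"
    and enc: "encodes c T r \<T> k"
begin

sublocale rooted_tree T r
  using inst root_in by unfold_locales (auto simp: mstbl_instance_def)

abbreviation "n \<equiv> n_verts c"
abbreviation "m \<equiv> length (edge_list c)"
abbreviation "q \<equiv> length (subs c)"

definition input :: "nat \<Rightarrow> nat" where "input = input_store (code_list c) ''in''"

definition verts :: "nat \<Rightarrow> nat list" where "verts j = fst (subs c ! j)"
definition edge_ids :: "nat \<Rightarrow> nat list" where "edge_ids j = fst (snd (subs c ! j))"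
definition mult :: "nat \<Rightarrow> nat" where "mult j = snd (snd (subs c ! j))"
definition objs :: "nat \<Rightarrow> nat list" where "objs j = verts j @ map ((+) n) (edge_ids j)"
definition graph :: "nat \<Rightarrow> nat graph" where "graph j = listed_graphs c ! j"
definition ob :: "nat \<Rightarrow> nat object" where
  "ob i = (if i < n then Vertex i else Edge (edge_of (edge_list c ! (i - n))))"

definition entry_list :: "nat \<Rightarrow> nat list" where
  "entry_list j = [mult j, length (verts j), length (edge_ids j)] @ verts j @ edge_ids j"
definition start :: "nat \<Rightarrow> nat" where
  "start j = 5 + m + m + m + n + (\<Sum>j'<j. length (entry_list j'))"

lemma length_objs: "length (objs j) = length (verts j) + length (edge_ids j)"
  by (simp add: objs_def)

lemma T_eq: "T = ({..<n}, edge_of ` set (edge_list c))"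
  and r_eq: "r = root_vertex c"
  and distinct_edges: "distinct (map edge_of (edge_list c))"
  and vcaps: "vertex_caps c = map (\<lambda>v. k (Vertex v)) [0..<n]"
  and ecaps: "edge_caps c = map (\<lambda>e. k (Edge (edge_of e))) (edge_list c)"
  and multiset: "\<T> = multiset_of (listed_graphs c) (listed_mults c)"
  using enc by (simp_all add: encodes_def)

lemma vertices_T: "vertices T = {..<n}" and edges_T: "edges T = edge_of ` set (edge_list c)"
  by (simp_all add: T_eq)

lemma entry_ok:
  assumes "j < q"
  shows "distinct (verts j)" "distinct (edge_ids j)" "set (edge_ids j) \<subseteq> {..<m}" "0 < mult j"
proof -
  have "\<forall>(vs, es, l)\<in>set (subs c). distinct vs \<and> distinct es \<and> set es \<subseteq> {..<m} \<and> 0 < l"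
    using enc by (simp add: encodes_def)
  moreover have "subs c ! j \<in> set (subs c)" using assms by simp
  ultimately have "case subs c ! j of (vs, es, l) \<Rightarrow>
      distinct vs \<and> distinct es \<and> set es \<subseteq> {..<m} \<and> 0 < l"
    by (rule bspec)
  then show "distinct (verts j)" "distinct (edge_ids j)" "set (edge_ids j) \<subseteq> {..<m}" "0 < mult j"
    by (simp_all add: verts_def edge_ids_def mult_def case_prod_beta)
qed

lemma graph_eq:
  "j < q \<Longrightarrow> graph j = (set (verts j), (\<lambda>i. edge_of (edge_list c ! i)) ` set (edge_ids j))"
  by (simp add: graph_def listed_graphs_def verts_def edge_ids_def case_prod_beta)

lemma multiset_sum: "\<T> = (\<Sum>j<q. replicate_mset (mult j) (graph j))"
  unfolding multiset multiset_of_def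
  by (intro sum.cong) (simp_all add: graph_def mult_def listed_graphs_def listed_mults_def case_prod_beta)

lemma graph_in:
  assumes "j < q"
  shows "graph j \<in># \<T>"
proof -
  have "\<T> = replicate_mset (mult j) (graph j) + (\<Sum>i\<in>{..<q} - {j}. replicate_mset (mult i) (graph i))"
    unfolding multiset_sum using assms by (intro sum.remove) auto
  then show ?thesis using entry_ok(4)[OF assms] by simp
qed

lemma subtree_graph: "j < q \<Longrightarrow> subtree (graph j) T"
  using inst graph_in by (auto simp: mstbl_instance_def)

lemma verts_less: "j < q \<Longrightarrow> set (verts j) \<subseteq> {..<n}"
  using subtree_graph[of j] graph_eq[of j] by (simp add: subtree_def vertices_T)

lemma objs_less: "j < q \<Longrightarrow> set (objs j) \<subseteq> {..<n + m}"
  using verts_less[of j] entry_ok(3)[of j] by (auto simp: objs_def)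

lemma distinct_objs: "j < q \<Longrightarrow> distinct (objs j)"
  using verts_less[of j] entry_ok[of j] by (auto simp: objs_def distinct_map)

lemma ob_vertex: "v < n \<Longrightarrow> ob v = Vertex v"
  and ob_edge: "ob (n + i) = Edge (edge_of (edge_list c ! i))"
  by (simp_all add: ob_def)

text \<open>Loads are stored per object number, so no object may have two numbers; for edges this is
  \<open>distinct_edges\<close>.\<close>

lemma inj_ob: "inj_on ob {..<n + m}"
proof (rule inj_onI)
  fix a b assume "a \<in> {..<n + m}" "b \<in> {..<n + m}" "ob a = ob b"
  moreover have "edge_of (edge_list c ! i) = edge_of (edge_list c ! j) \<longleftrightarrow> i = j"
    if "i < m" "j < m" for i j
    using distinct_edges that by (metis length_map nth_eq_iff_index_eq nth_map)
  ultimately show "a = b" by (auto simp: ob_def split: if_splits)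
qed

lemma objects_T: "objects T = ob ` {..<n + m}"
proof -
  have "{..<n + m} = {..<n} \<union> (+) n ` {..<m}"
  proof -
    have "x \<in> (+) n ` {..<m}" if "x < n + m" "n \<le> x" for x
      using that by (intro image_eqI[of _ _ "x - n"]) auto
    then show ?thesis by fastforce
  qed
  then have "ob ` {..<n + m} = Vertex ` {..<n} \<union> (\<lambda>i. Edge (edge_of (edge_list c ! i))) ` {..<m}"
    by (simp add: image_Un image_image ob_vertex ob_edge)
  also have "set (edge_list c) = (!) (edge_list c) ` {..<m}" by (auto simp: set_conv_nth)
  then have "(\<lambda>i. Edge (edge_of (edge_list c ! i))) ` {..<m} = Edge ` edge_of ` set (edge_list c)"
    by (simp add: image_image)
  finally show ?thesis by (simp add: objects_def vertices_T edges_T)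
qed

lemma objects_graph:
  assumes "j < q"
  shows "objects (graph j) = ob ` set (objs j)"
proof -
  have "ob ` set (verts j) = Vertex ` set (verts j)"
    using verts_less[OF assms] by (intro image_cong) (auto simp: ob_vertex)
  moreover have "ob ` (+) n ` set (edge_ids j) = Edge ` (\<lambda>i. edge_of (edge_list c ! i)) ` set (edge_ids j)"
    by (simp add: image_image ob_edge)
  ultimately show ?thesis using assms by (simp add: objects_def graph_eq objs_def image_Un)
qed

lemma ob_in_graph: "j < q \<Longrightarrow> i < n + m \<Longrightarrow> ob i \<in> objects (graph j) \<longleftrightarrow> i \<in> set (objs j)"
  using inj_on_image_mem_iff[OF inj_ob, of i "set (objs j)"] objs_less[of j]
  by (simp add: objects_graph)

lemma code_eq:
  "code_list c = [n, m, q, r] @ concat (map (\<lambda>(u, v). [u, v]) (edge_list c))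
     @ (vertex_caps c @ edge_caps c) @ concat (map entry_list [0..<q])"
proof -
  have "map entry_list [0..<q] = map (\<lambda>(vs, es, m). [m, length vs, length es] @ vs @ es) (subs c)"
    by (rule nth_equalityI)
      (simp_all add: entry_list_def mult_def verts_def edge_ids_def case_prod_beta)
  then show ?thesis by (simp add: code_list_def r_eq)
qed

lemma length_edge_code: "length (concat (map (\<lambda>(u, v). [u, v]) es)) = length es + length es"
  by (induction es) auto

lemma length_caps: "length (vertex_caps c @ edge_caps c) = n + m"
  by (simp add: vcaps ecaps)

lemma input_header [simp]: "input (Suc 0) = n" "input 2 = m" "input 3 = q" "input 4 = r"
  by (simp_all add: input_def input_store_def code_eq)

lemma input_edge:
  assumes "i < m"
  shows "input (5 + (i + i)) = fst (edge_list c ! i)" "input (6 + (i + i)) = snd (edge_list c ! i)"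
proof -
  let ?xss = "map (\<lambda>(u, v). [u, v]) (edge_list c)"
  have len: "length (?xss ! j) = 2" if "j < m" for j
    using that by (simp add: case_prod_beta)
  have s: "(\<Sum>j<i. length (?xss ! j)) = i + i"
    using assms len by (simp add: mult_2_right)
  have *: "input (5 + (i + i) + l) = ?xss ! i ! l" if "l < 2" for l
  proof -
    have l: "l < length (?xss ! i)" using len assms that by simp
    have "input (Suc (length [n, m, q, r] + (i + i + l))) = concat ?xss ! (i + i + l)"
      unfolding input_def code_eq
      using nth_concat_less[of i ?xss l] l assms by (intro input_store_append) (simp only: s length_map)
    also have "\<dots> = ?xss ! i ! l"
      using nth_concat[of i ?xss l] l assms by (simp only: s length_map)
    also have "Suc (length [n, m, q, r] + (i + i + l)) = 5 + (i + i) + l" by simp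
    finally show ?thesis .
  qed
  have "6 + (i + i) = 5 + (i + i) + 1" by simp
  then show "input (5 + (i + i)) = fst (edge_list c ! i)" "input (6 + (i + i)) = snd (edge_list c ! i)"
    using *[of 0] *[of 1] assms by (simp_all only: nth_map) (simp_all add: case_prod_beta)
qed

lemma input_cap:
  assumes "i < n + m"
  shows "input (5 + (m + (m + i))) = k (ob i)"
proof -
  let ?es = "concat (map (\<lambda>(u, v). [u, v]) (edge_list c))"
  have "input (Suc (length ([n, m, q, r] @ ?es) + i)) = (vertex_caps c @ edge_caps c) ! i"
    unfolding input_def code_eq append.assoc[symmetric, of "[n, m, q, r]" ?es]
    using assms length_caps by (intro input_store_append) simp
  also have "\<dots> = k (ob i)"
    using assms by (auto simp: vcaps ecaps nth_append ob_def)
  also have "Suc (length ([n, m, q, r] @ ?es) + i) = 5 + (m + (m + i))"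
    by (simp add: length_edge_code)
  finally show ?thesis .
qed

lemma input_entry:
  assumes "j < q" "i < length (entry_list j)"
  shows "input (start j + i) = entry_list j ! i"
proof -
  let ?pre = "[n, m, q, r] @ concat (map (\<lambda>(u, v). [u, v]) (edge_list c)) @ vertex_caps c @ edge_caps c"
  let ?xss = "map entry_list [0..<q]"
  have code: "code_list c = ?pre @ concat ?xss @ []" by (simp add: code_eq)
  have s: "(\<Sum>j'<j. length (?xss ! j')) = (\<Sum>j'<j. length (entry_list j'))"
    using assms by (intro sum.cong) auto
  have len: "length ?pre = 4 + m + m + m + n"
    using length_caps by (simp add: length_edge_code)
  let ?a = "\<Sum>j'<j. length (entry_list j')"
  have "input (Suc (length ?pre + (?a + i))) = concat ?xss ! (?a + i)"
    unfolding input_def code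
    by (rule input_store_append) (use nth_concat_less[of j ?xss i] assms s in simp)
  also have "\<dots> = ?xss ! j ! i"
    using nth_concat[of j ?xss i] assms s by simp
  also have "Suc (length ?pre + (?a + i)) = start j + i"
    unfolding len start_def by simp
  finally show ?thesis using assms by simp
qed

lemma entry_simps:
  assumes "j < q"
  shows "input (start j) = mult j" "input (Suc (start j)) = length (verts j)"
    "input (Suc (Suc (start j))) = length (edge_ids j)"
    "i < length (verts j) \<Longrightarrow> input (start j + (3 + i)) = verts j ! i"
    "length (verts j) \<le> i \<Longrightarrow> i < length (objs j) \<Longrightarrow>
       input (start j + (3 + i)) = edge_ids j ! (i - length (verts j))"
  using input_entry[OF assms, of 0] input_entry[OF assms, of 1] input_entry[OF assms, of 2]
    input_entry[OF assms, of "3 + i"]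
  by (auto simp: entry_list_def objs_def nth_append numeral_3_eq_3 numeral_2_eq_2)

lemma start_Suc: "start (Suc j) = start j + (3 + (length (verts j) + length (edge_ids j)))"
  by (simp add: start_def entry_list_def)

definition N :: nat where "N = input_size (code_list c)"

text \<open>Each listed number has at least one bit. Even \<open>n\<close>, itself written in
  binary, is bounded by \<open>N\<close>, because one capacity per vertex is listed.\<close>

lemma sizes: "n \<le> N" "m \<le> N" "q \<le> N" "j < q \<Longrightarrow> length (objs j) \<le> N"
proof -
  have "length (code_list c) = 4 + (m + m) + (n + m) + (\<Sum>j<q. length (entry_list j))"
    unfolding code_eq length_append length_edge_code length_concat_nth[of "map entry_list [0..<q]"]
    using length_caps by simp
  then have *: "4 + (m + m) + (n + m) + (\<Sum>j<q. length (entry_list j)) \<le> N"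
    using length_le_input_size[of "code_list c"] by (simp add: N_def)
  have "(\<Sum>j<q. 1) \<le> (\<Sum>j<q. length (entry_list j))"
    by (intro sum_mono) (simp add: entry_list_def)
  then show "n \<le> N" "m \<le> N" "q \<le> N" using * by auto
  show "length (objs j) \<le> N" if "j < q"
  proof -
    have "length (entry_list j) \<le> (\<Sum>j<q. length (entry_list j))"
      using that by (intro member_le_sum) auto
    then show ?thesis using * by (simp add: entry_list_def length_objs)
  qed
qed


section \<open>Correctness of the program\<close>

definition inputs :: "store \<Rightarrow> bool" where
  "inputs s \<longleftrightarrow> s ''in'' = input \<and> s ''g'' 0 = 0 \<and> s ''g'' 1 = n"

definition fresh :: "store \<Rightarrow> bool" where
  "fresh s \<longleftrightarrow> (\<forall>i. s ''l'' i = 0) \<and> (\<forall>i. s ''out'' i = 0)"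

lemma inputs_upd [simp]: "x \<noteq> ''in'' \<Longrightarrow> x \<noteq> ''g'' \<Longrightarrow> inputs (s(x := f)) = inputs s"
  by (simp add: inputs_def)

lemma fresh_upd [simp]: "x \<noteq> ''l'' \<Longrightarrow> x \<noteq> ''out'' \<Longrightarrow> fresh (s(x := f)) = fresh s"
  by (simp add: fresh_def)

lemma in_eq: "inputs s \<Longrightarrow> s ''in'' = input"
  by (simp add: inputs_def)

lemma edge_nth: "i < m \<Longrightarrow> {fst (edge_list c ! i), snd (edge_list c ! i)} \<in> edges T"
  by (auto simp: edges_T edge_of_def)

lemma edgeE:
  assumes "{u, v} \<in> edges T"
  obtains i where "i < m" "{u, v} = {fst (edge_list c ! i), snd (edge_list c ! i)}"
proof -
  obtain e where "e \<in> set (edge_list c)" "{u, v} = edge_of e" using assms by (auto simp: edges_T)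
  then show ?thesis using that by (auto simp: in_set_conv_nth edge_of_def)
qed


subsection \<open>Depths\<close>

text \<open>Closure under \<open>parent\<close> ensures that an edge is never relaxed from a child
  to its parent, which would store a wrong depth.\<close>

definition partial_depths :: "(nat \<Rightarrow> nat) \<Rightarrow> bool" where
  "partial_depths f \<longleftrightarrow> f r \<noteq> 0 \<and> (\<forall>v<n. f v = 0 \<or> f v = Suc (depth v)) \<and>
     (\<forall>v<n. v \<noteq> r \<longrightarrow> f v \<noteq> 0 \<longrightarrow> f (parent v) \<noteq> 0)"

definition relaxed :: "nat \<Rightarrow> nat \<Rightarrow> (nat \<Rightarrow> nat) \<Rightarrow> nat \<Rightarrow> nat" where
  "relaxed u v f = (if f v = 0 \<and> f u \<noteq> 0 then f(v := Suc (f u)) else f)"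

lemma hoare_relax:
  assumes "\<And>s. P s \<Longrightarrow> Q (s(''d'' := relaxed (val s a) (val s b) (s ''d'')))" "3 \<le> l"
  shows "hoare P (relax a b) l Q"
  unfolding relax_def
  by (intro hoare_If[where n = 2] hoare_If[where n = 1] hoare_Assign hoare_Skip)
    (use assms in \<open>auto simp: relaxed_def fun_upd_idem split: if_splits dest!: assms(1)\<close>)

lemma relaxed_partial_depths:
  assumes "{u, v} \<in> edges T" "partial_depths f"
  shows "partial_depths (relaxed u v f)"
proof (cases "f v = 0 \<and> f u \<noteq> 0")
  case True
  have uv: "u < n" "v < n" using edgeD[OF assms(1)] by (auto simp: vertices_T)
  have vr: "v \<noteq> r" using True assms(2) by (auto simp: partial_depths_def)
  have "v = parent u \<Longrightarrow> u \<noteq> r \<Longrightarrow> False"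
    using True assms(2) uv by (auto simp: partial_depths_def)
  then have p: "u = parent v" using assms(1) by (elim edge_parent) auto
  have "depth v = Suc (depth u)" using parent(2)[of v] uv vr p by (simp add: vertices_T)
  moreover have "f u = Suc (depth u)" using True assms(2) uv by (auto simp: partial_depths_def)
  ultimately show ?thesis
    using True assms(2) uv p vr unfolding partial_depths_def relaxed_def by auto
qed (use assms in \<open>auto simp: relaxed_def\<close>)

lemma relaxed_pos: "f w \<noteq> 0 \<Longrightarrow> relaxed u v f w \<noteq> 0" "f u \<noteq> 0 \<Longrightarrow> relaxed u v f v \<noteq> 0"
  by (auto simp: relaxed_def)

text \<open>Only a lower bound on the progress: updates are made in place, so a round may already
  reach deeper vertices.\<close>

definition reached :: "nat \<Rightarrow> (nat \<Rightarrow> nat) \<Rightarrow> bool" where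
  "reached l f \<longleftrightarrow> (\<forall>v<n. depth v \<le> l \<longrightarrow> f v \<noteq> 0)"

definition reached_edges :: "nat \<Rightarrow> nat \<Rightarrow> (nat \<Rightarrow> nat) \<Rightarrow> bool" where
  "reached_edges l i f \<longleftrightarrow> (\<forall>i'<i. let (u, v) = edge_list c ! i' in
     (depth u \<le> l \<longrightarrow> f v \<noteq> 0) \<and> (depth v \<le> l \<longrightarrow> f u \<noteq> 0))"

lemma reached_mono: "(\<And>v. f v \<noteq> 0 \<Longrightarrow> g v \<noteq> 0) \<Longrightarrow> reached l f \<Longrightarrow> reached l g"
  unfolding reached_def by blast

lemma reached_edges_mono:
  "(\<And>v. f v \<noteq> 0 \<Longrightarrow> g v \<noteq> 0) \<Longrightarrow> reached_edges l i f \<Longrightarrow> reached_edges l i g"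
  unfolding reached_edges_def by (fastforce simp: Let_def case_prod_beta)

lemma reached_step:
  assumes "reached l f" "reached_edges l m f"
  shows "reached (Suc l) f"
  unfolding reached_def
proof (intro allI impI)
  fix v assume v: "v < n" "depth v \<le> Suc l"
  show "f v \<noteq> 0"
  proof (cases "depth v \<le> l")
    case True
    then show ?thesis using assms v by (simp add: reached_def)
  next
    case False
    then have "v \<noteq> r" by auto
    then have p: "{parent v, v} \<in> edges T" "depth v = Suc (depth (parent v))"
      using parent[of v] v by (auto simp: vertices_T)
    then obtain i where "i < m" "{parent v, v} = {fst (edge_list c ! i), snd (edge_list c ! i)}"
      by (elim edgeE)
    then show ?thesis using assms(2) p(2) v(2)
      by (auto simp: reached_edges_def Let_def case_prod_beta doubleton_eq_iff)
  qed
qed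

definition depth_inv :: "nat \<Rightarrow> store \<Rightarrow> bool" where
  "depth_inv l s \<longleftrightarrow> inputs s \<and> fresh s \<and> partial_depths (s ''d'') \<and> reached l (s ''d'')"

lemma depth_inv_upd [simp]: "x \<notin> {''in'', ''g'', ''l'', ''out'', ''d''} \<Longrightarrow>
    depth_inv l (s(x := f)) = depth_inv l s"
  by (auto simp: depth_inv_def)

lemma hoare_relax_edge:
  assumes "i < m"
  shows "hoare (\<lambda>s. ((depth_inv l s \<and> reached_edges l i (s ''d'')) \<and> s ''y'' 0 = l) \<and> s ''i'' 0 = i)
    (Seq (relax edge_src edge_tgt) (relax edge_tgt edge_src)) 6
    (\<lambda>s. ((depth_inv l s \<and> reached_edges l (Suc i) (s ''d'')) \<and> s ''y'' 0 = l) \<and> s ''i'' 0 = i)"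
proof -
  let ?u = "fst (edge_list c ! i)" and ?v = "snd (edge_list c ! i)"
  have e: "{?u, ?v} \<in> edges T" "{?v, ?u} \<in> edges T"
    using edge_nth[OF assms] by (simp_all add: insert_commute)
  have uv: "?u < n" "?v < n" using edgeD[OF e(1)] by (auto simp: vertices_T)
  have vals: "val s edge_src = ?u" "val s edge_tgt = ?v" if "inputs s" "s ''i'' 0 = i" for s
    using that input_edge[OF assms] by (simp_all add: in_eq)
  let ?R = "\<lambda>s. (((depth_inv l s \<and> reached_edges l i (s ''d'')) \<and> s ''y'' 0 = l) \<and> s ''i'' 0 = i) \<and>
      (depth ?u \<le> l \<longrightarrow> s ''d'' ?v \<noteq> 0)"
  show ?thesis
  proof (rule hoare_Seq[where m = 3 and n = 3 and R = ?R])
    show "hoare (\<lambda>s. ((depth_inv l s \<and> reached_edges l i (s ''d'')) \<and> s ''y'' 0 = l) \<and> s ''i'' 0 = i)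
      (relax edge_src edge_tgt) 3 ?R"
    proof (rule hoare_relax)
      fix s assume s: "((depth_inv l s \<and> reached_edges l i (s ''d'')) \<and> s ''y'' 0 = l) \<and> s ''i'' 0 = i"
      let ?f = "relaxed ?u ?v (s ''d'')"
      have "partial_depths ?f" "reached l ?f" "reached_edges l i ?f"
        using s e relaxed_partial_depths reached_mono[OF relaxed_pos(1)]
          reached_edges_mono[OF relaxed_pos(1)] by (auto simp: depth_inv_def)
      moreover have "depth ?u \<le> l \<longrightarrow> ?f ?v \<noteq> 0"
        using s uv relaxed_pos(2) by (auto simp: depth_inv_def reached_def)
      moreover have "inputs s" using s by (simp add: depth_inv_def)
      ultimately show "?R (s(''d'' := relaxed (val s edge_src) (val s edge_tgt) (s ''d'')))"
        using s vals[of s] by (simp add: depth_inv_def del: val.simps)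
    qed simp
    show "hoare ?R (relax edge_tgt edge_src) 3
      (\<lambda>s. ((depth_inv l s \<and> reached_edges l (Suc i) (s ''d'')) \<and> s ''y'' 0 = l) \<and> s ''i'' 0 = i)"
    proof (rule hoare_relax)
      fix s assume s: "?R s"
      let ?f = "relaxed ?v ?u (s ''d'')"
      have "partial_depths ?f" "reached l ?f" "reached_edges l i ?f"
        using s e relaxed_partial_depths reached_mono[OF relaxed_pos(1)]
          reached_edges_mono[OF relaxed_pos(1)] by (auto simp: depth_inv_def)
      moreover have "depth ?u \<le> l \<longrightarrow> ?f ?v \<noteq> 0" using s relaxed_pos(1) by auto
      moreover have "depth ?v \<le> l \<longrightarrow> ?f ?u \<noteq> 0"
        using s uv relaxed_pos(2) by (auto simp: depth_inv_def reached_def)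
      moreover have "inputs s" using s by (simp add: depth_inv_def)
      ultimately show "(\<lambda>s. ((depth_inv l s \<and> reached_edges l (Suc i) (s ''d'')) \<and> s ''y'' 0 = l) \<and> s ''i'' 0 = i)
          (s(''d'' := relaxed (val s edge_tgt) (val s edge_src) (s ''d'')))"
        using s vals[of s]
        by (simp add: depth_inv_def reached_edges_def less_Suc_eq Let_def case_prod_beta del: val.simps)
    qed simp
  qed simp
qed

definition depths_done :: "store \<Rightarrow> bool" where
  "depths_done s \<longleftrightarrow> inputs s \<and> fresh s \<and> (\<forall>v<n. s ''d'' v = Suc (depth v))"

lemma depth_inv_done:
  assumes "depth_inv n s"
  shows "depths_done s"
proof -
  have "s ''d'' v = Suc (depth v)" if "v < n" for v
  proof -
    have "depth v \<le> n" using depth_less_card[of v] that by (simp add: vertices_T)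
    then have "s ''d'' v \<noteq> 0" using assms that by (simp add: depth_inv_def reached_def)
    then show ?thesis using assms that by (auto simp: depth_inv_def partial_depths_def)
  qed
  then show ?thesis using assms by (simp add: depths_done_def depth_inv_def)
qed

lemma hoare_depths:
  "hoare (\<lambda>s. inputs s \<and> fresh s \<and> (\<forall>v. s ''d'' v = 0)) depths_prog
     (1 + (2 + n * (2 + m * 8 + 2))) depths_done"
  unfolding depths_prog_def
proof (rule hoare_Seq[where m = 1 and R = "depth_inv 0"])
  show "hoare (\<lambda>s. inputs s \<and> fresh s \<and> (\<forall>v. s ''d'' v = 0))
      (Assign ''d'' (In (Num 4)) (Num 1)) 1 (depth_inv 0)"
  proof (rule hoare_Assign)
    fix s assume s: "inputs s \<and> fresh s \<and> (\<forall>v. s ''d'' v = 0)"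
    have "v = r" if "v < n" "depth v = 0" for v
      using depth_0D[of v] that by (simp add: vertices_T)
    then have "depth_inv 0 (s(''d'' := (s ''d'')(r := 1)))"
      using s by (auto simp: depth_inv_def partial_depths_def reached_def)
    then show "depth_inv 0 (s(''d'' := (s ''d'')(val s (In (Num 4)) := val s (Num 1))))"
      using s input_header(4) by (simp add: in_eq)
  qed simp
  have inner: "hoare (\<lambda>s. depth_inv l s \<and> s ''y'' 0 = l)
      (For ''i'' (In (Num 2)) (Seq (relax edge_src edge_tgt) (relax edge_tgt edge_src)))
      (2 + m * 8) (\<lambda>s. depth_inv (Suc l) s \<and> s ''y'' 0 = l)" for l
  by (rule hoare_For[where N = m and n = 6 and
        I = "\<lambda>i s. (depth_inv l s \<and> reached_edges l i (s ''d'')) \<and> s ''y'' 0 = l", OF hoare_relax_edge])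
    (auto simp: in_eq input_header depth_inv_def reached_edges_def intro: reached_step)
  show "hoare (depth_inv 0) (For ''y'' (In (Num 1)) (For ''i'' (In (Num 2))
       (Seq (relax edge_src edge_tgt) (relax edge_tgt edge_src)))) (2 + n * (2 + m * 8 + 2)) depths_done"
    by (rule hoare_For[where N = n and I = depth_inv, OF inner])
      (auto simp: in_eq input_header depth_inv_def[of _ s for s] depth_inv_done)
qed simp


subsection \<open>Scanning the subtrees\<close>

lemma depths_done_upd [simp]: "x \<notin> {''in'', ''g'', ''l'', ''out'', ''d''} \<Longrightarrow>
    depths_done (s(x := f)) = depths_done s"
  by (auto simp: depths_done_def)

definition scan_inv :: "nat \<Rightarrow> store \<Rightarrow> bool" where
  "scan_inv j s \<longleftrightarrow> depths_done s \<and> s ''p'' 0 = start j \<and>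
     (\<forall>j'<j. s ''b'' j' = start j' \<and> s ''h'' j' = Suc (depth (top_of (graph j'))))"

text \<open>The invariant of both minimum loops, the one for the depth of a root and the one for the
  number of accepted copies. It describes the minimum as a lower bound that is attained, possibly by
  the start value \<open>a\<close>.\<close>

definition partial_min :: "(nat \<Rightarrow> nat) \<Rightarrow> nat list \<Rightarrow> nat \<Rightarrow> nat \<Rightarrow> nat \<Rightarrow> bool" where
  "partial_min f xs a i x \<longleftrightarrow> x \<le> a \<and> (\<forall>i'<i. x \<le> f (xs ! i')) \<and> (x = a \<or> (\<exists>i'<i. x = f (xs ! i')))"

lemma partial_min_0: "partial_min f xs a 0 a"
  by (simp add: partial_min_def)

lemma partial_min_Suc:
  "partial_min f xs a i x \<Longrightarrow> partial_min f xs a (Suc i) (x - (x - f (xs ! i)))"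
  unfolding partial_min_def less_Suc_eq by (cases "x \<le> f (xs ! i)") auto

lemma partial_min_length:
  "partial_min f xs a (length xs) x \<longleftrightarrow>
     x \<le> a \<and> (\<forall>y\<in>set xs. x \<le> f y) \<and> (x = a \<or> (\<exists>y\<in>set xs. x = f y))"
  unfolding partial_min_def by (auto simp: in_set_conv_nth all_set_conv_all_nth)

text \<open>The start value \<open>Suc n\<close> exceeds every depth plus 1, so the minimum is
  attained at a vertex.\<close>

lemma partial_min_depth:
  assumes j: "j < q" and "partial_min (\<lambda>v. Suc (depth v)) (verts j) (Suc n) (length (verts j)) x"
  shows "x = Suc (depth (top_of (graph j)))"
proof -
  have V: "vertices (graph j) = set (verts j)" using graph_eq[OF j] by simp
  note top = top_of[OF subtree_graph[OF j], unfolded V]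
  have "depth (top_of (graph j)) < n"
    using top(1) verts_less[OF j] depth_less_card[of "top_of (graph j)"] by (auto simp: vertices_T)
  then show ?thesis
    using assms(2) top unfolding partial_min_length by (auto simp: le_antisym Ball_def)
qed

lemma hoare_scan_entry:
  assumes j: "j < q"
  shows "hoare (\<lambda>s. scan_inv j s \<and> s ''j'' 0 = j) scan_entry (5 + 3 * length (verts j))
    (\<lambda>s. scan_inv (Suc j) s \<and> s ''j'' 0 = j)"
proof -
  let ?B = "\<lambda>s. scan_inv j s \<and> s ''j'' 0 = j \<and> s ''b'' j = start j"
  let ?I = "\<lambda>i s. ?B s \<and> partial_min (\<lambda>v. Suc (depth v)) (verts j) (Suc n) i (s ''h'' j)"
  have in_s: "s ''in'' = input" if "scan_inv j s" for s
    using that by (simp add: scan_inv_def depths_done_def in_eq)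
  have p: "s ''p'' 0 = start j" if "scan_inv j s" for s
    using that by (simp add: scan_inv_def)
  have d: "s ''d'' (verts j ! i) = Suc (depth (verts j ! i))"
    if "scan_inv j s" "i < length (verts j)" for s i
    using that verts_less[OF j] by (auto simp: scan_inv_def depths_done_def subset_iff)
  have upd: "scan_inv j (s(''h'' := (s ''h'')(j := v))) = scan_inv j s"
    "scan_inv j (s(''b'' := (s ''b'')(j := v))) = scan_inv j s"
    "scan_inv j (s(''i'' := f)) = scan_inv j s" for s v f
    by (auto simp: scan_inv_def)
  have h: "s ''h'' j = Suc (depth (top_of (graph j)))" if "?I (length (verts j)) s" for s
    using that partial_min_depth[OF j] by blast
  show ?thesis
    unfolding scan_entry_def
  proof (rule hoare_Seq[where m = 1 and R = ?B])
    show "hoare (\<lambda>s. scan_inv j s \<and> s ''j'' 0 = j) (Assign ''b'' (Var ''j'') (Var ''p'')) 1 ?B"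
      by (rule hoare_Assign) (simp_all add: upd p)
    show "hoare ?B (Seq (Assign ''h'' (Var ''j'') (Add (In (Num 1)) (Num 1)))
      (Seq (For ''i'' (In (Add (Var ''p'') (Num 1)))
           (Assign ''h'' (Var ''j'') (Monus (Cell ''h'' (Var ''j'')) (Monus (Cell ''h'' (Var ''j''))
              (Cell ''d'' (In (Add (Var ''p'') (Add (Num 3) (Var ''i'')))))))))
         (Assign ''p'' (Num 0) (Add (Var ''p'') (Add (Num 3)
            (Add (In (Add (Var ''p'') (Num 1))) (In (Add (Var ''p'') (Num 2)))))))))
       (4 + 3 * length (verts j)) (\<lambda>s. scan_inv (Suc j) s \<and> s ''j'' 0 = j)"
    proof (rule hoare_Seq[where m = 1 and R = "?I 0"])
      show "hoare ?B (Assign ''h'' (Var ''j'') (Add (In (Num 1)) (Num 1))) 1 (?I 0)"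
        by (rule hoare_Assign) (simp_all add: upd in_s partial_min_0)
      show "hoare (?I 0) (Seq (For ''i'' (In (Add (Var ''p'') (Num 1)))
           (Assign ''h'' (Var ''j'') (Monus (Cell ''h'' (Var ''j'')) (Monus (Cell ''h'' (Var ''j''))
              (Cell ''d'' (In (Add (Var ''p'') (Add (Num 3) (Var ''i'')))))))))
         (Assign ''p'' (Num 0) (Add (Var ''p'') (Add (Num 3)
            (Add (In (Add (Var ''p'') (Num 1))) (In (Add (Var ''p'') (Num 2))))))))
         (3 + 3 * length (verts j)) (\<lambda>s. scan_inv (Suc j) s \<and> s ''j'' 0 = j)"
      proof (rule hoare_Seq[where n = 1 and R = "?I (length (verts j))"])
        show "hoare (?I 0) (For ''i'' (In (Add (Var ''p'') (Num 1)))
           (Assign ''h'' (Var ''j'') (Monus (Cell ''h'' (Var ''j'')) (Monus (Cell ''h'' (Var ''j''))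
              (Cell ''d'' (In (Add (Var ''p'') (Add (Num 3) (Var ''i'')))))))))
           (2 + length (verts j) * (1 + 2)) (?I (length (verts j)))"
          by (rule hoare_For[where I = ?I and n = 1 and N = "length (verts j)", OF hoare_Assign])
            (auto simp: upd in_s p d entry_simps[OF j]
                partial_min_Suc[where f = "\<lambda>v. Suc (depth v)"])
        show "hoare (?I (length (verts j))) (Assign ''p'' (Num 0) (Add (Var ''p'') (Add (Num 3)
            (Add (In (Add (Var ''p'') (Num 1))) (In (Add (Var ''p'') (Num 2))))))) 1
            (\<lambda>s. scan_inv (Suc j) s \<and> s ''j'' 0 = j)"
        proof (rule hoare_Assign)
          fix s assume s: "?I (length (verts j)) s"
          have "val s (Add (Var ''p'') (Add (Num 3)
            (Add (In (Add (Var ''p'') (Num 1))) (In (Add (Var ''p'') (Num 2)))))) = start (Suc j)"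
            using s by (simp add: in_s p entry_simps[OF j] start_Suc)
          then show "scan_inv (Suc j) (s(''p'' := (s ''p'')(val s (Num 0) := val s (Add (Var ''p'') (Add (Num 3)
            (Add (In (Add (Var ''p'') (Num 1))) (In (Add (Var ''p'') (Num 2)))))))))
            \<and> (s(''p'' := (s ''p'')(val s (Num 0) := val s (Add (Var ''p'') (Add (Num 3)
            (Add (In (Add (Var ''p'') (Num 1))) (In (Add (Var ''p'') (Num 2))))))))) ''j'' 0 = j"
            using s h[OF s] by (auto simp: scan_inv_def less_Suc_eq simp del: val.simps(2-4))
        qed simp
      qed simp
    qed simp
  qed simp
qed

definition scanned :: "store \<Rightarrow> bool" where
  "scanned s \<longleftrightarrow> inputs s \<and>
     (\<forall>j<q. s ''b'' j = start j \<and> s ''h'' j = Suc (depth (top_of (graph j))))"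

lemma hoare_scan:
  "hoare depths_done scan_prog (1 + (2 + q * (5 + 3 * N + 2))) (\<lambda>s. scanned s \<and> fresh s)"
  unfolding scan_prog_def
proof (rule hoare_Seq[where m = 1 and R = "scan_inv 0"])
  show "hoare depths_done (Assign ''p'' (Num 0)
      (Add (Num 5) (Add (In (Num 2)) (Add (In (Num 2)) (Add (In (Num 2)) (In (Num 1))))))) 1 (scan_inv 0)"
    by (rule hoare_Assign) (auto simp: scan_inv_def depths_done_def in_eq start_def)
  have body: "hoare (\<lambda>s. scan_inv j s \<and> s ''j'' 0 = j) scan_entry (5 + 3 * N)
      (\<lambda>s. scan_inv (Suc j) s \<and> s ''j'' 0 = j)" if "j < q" for j
  proof -
    have "length (verts j) \<le> N" using sizes(4)[OF that] by (simp add: length_objs)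
    then show ?thesis by (intro hoare_conseq[OF hoare_scan_entry[OF that]]) auto
  qed
  show "hoare (scan_inv 0) (For ''j'' (In (Num 3)) scan_entry) (2 + q * (5 + 3 * N + 2))
      (\<lambda>s. scanned s \<and> fresh s)"
    by (rule hoare_For[where I = scan_inv and N = q, OF body])
      (auto simp: scan_inv_def scanned_def depths_done_def in_eq)
qed simp


subsection \<open>Selecting copies\<close>

definition copies :: "nat list \<Rightarrow> nat graph list" where
  "copies js = concat (map (\<lambda>j. replicate (mult j) (graph j)) js)"

lemma feasible_iff: "feasible T k U \<longleftrightarrow> (\<forall>i<n + m. load U (ob i) \<le> k (ob i))"
  by (auto simp: feasible_def objects_T)

lemma feasible_greedy: "feasible T k (greedy_select T k Ss)"
  using greedy_sound[of T k "{#}" Ss] by (simp add: greedy_select_def)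

text \<open>\<open>x\<close> copies fit as \<open>x\<close> is at most every residual capacity. If
  \<open>x\<close> is below the multiplicity, the minimum is attained at an object that
  \<open>x\<close> copies saturate, so a further copy is infeasible.\<close>

lemma greedy_select_copies:
  assumes j: "j < q" and x: "partial_min (\<lambda>i. k (ob i) - load (greedy_select T k (copies js)) (ob i))
      (objs j) (mult j) (length (objs j)) x"
  shows "greedy_select T k (copies (js @ [j]))
    = greedy_select T k (copies js) + replicate_mset x (graph j)"
proof -
  let ?U = "greedy_select T k (copies js)"
  have U: "load ?U (ob i) \<le> k (ob i)" if "i < n + m" for i
    using feasible_greedy[of "copies js"] that by (simp add: feasible_iff)
  have less: "i < n + m" if "i \<in> set (objs j)" for i
    using objs_less[OF j] that by auto
  note x' = x[unfolded partial_min_length]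
  have "feasible T k (?U + replicate_mset x (graph j))"
    unfolding feasible_iff
  proof (intro allI impI)
    fix i assume i: "i < n + m"
    then show "load (?U + replicate_mset x (graph j)) (ob i) \<le> k (ob i)"
      using x' U[OF i] by (cases "i \<in> set (objs j)") (force simp: ob_in_graph[OF j i])+
  qed
  moreover have "\<not> feasible T k (?U + replicate_mset (Suc x) (graph j))" if "x < mult j"
  proof -
    obtain i where i: "i \<in> set (objs j)" "x = k (ob i) - load ?U (ob i)" using x' \<open>x < mult j\<close> by auto
    have "\<not> load (?U + replicate_mset (Suc x) (graph j)) (ob i) \<le> k (ob i)"
      using i less[OF i(1)] ob_in_graph[OF j, of i] by (simp del: replicate_mset_Suc)
    then show ?thesis unfolding feasible_iff using less[OF i(1)] by blast
  qed
  moreover have "x \<le> mult j" using x' by simp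
  ultimately have "foldl (greedy_step T k) ?U (replicate (mult j) (graph j)) = ?U + replicate_mset x (graph j)"
    by (intro foldl_greedy_replicate)
  then show ?thesis by (simp add: greedy_select_def copies_def)
qed

lemma output_sum:
  "multiset_of (listed_graphs c) (output_list q s) = (\<Sum>j<q. replicate_mset (s ''out'' j) (graph j))"
proof -
  have "length (listed_graphs c) = q" by (simp add: listed_graphs_def)
  then show ?thesis unfolding multiset_of_def by (intro sum.cong) (simp_all add: graph_def output_list_def)
qed

lemma output_upd:
  assumes "j < q" "s ''out'' j = 0"
  shows "multiset_of (listed_graphs c) (output_list q (s(''out'' := (s ''out'')(j := x))))
    = multiset_of (listed_graphs c) (output_list q s) + replicate_mset x (graph j)"
proof -
  have "(\<Sum>i<q. replicate_mset (((s ''out'')(j := x)) i) (graph i))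
      = replicate_mset x (graph j) + (\<Sum>i\<in>{..<q} - {j}. replicate_mset (((s ''out'')(j := x)) i) (graph i))"
    using assms by (subst sum.remove[of _ j]) auto
  also have "(\<Sum>i\<in>{..<q} - {j}. replicate_mset (((s ''out'')(j := x)) i) (graph i))
      = (\<Sum>i\<in>{..<q} - {j}. replicate_mset (s ''out'' i) (graph i))"
    by (intro sum.cong) auto
  also have "\<dots> = (\<Sum>i<q. replicate_mset (s ''out'' i) (graph i))"
    using assms by (subst (2) sum.remove[of _ j]) auto
  finally show ?thesis by (simp add: output_sum add.commute)
qed

text \<open>\<open>js\<close> lists the processed entries in the order of processing. The zeros
  elsewhere make writing an output cell add exactly the copies written, as \<open>output_upd\<close>
  requires.\<close>

definition output_inv :: "nat list \<Rightarrow> store \<Rightarrow> bool" where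
  "output_inv js s \<longleftrightarrow> scanned s \<and>
     multiset_of (listed_graphs c) (output_list q s) = greedy_select T k (copies js) \<and>
     (\<forall>j<q. j \<notin> set js \<longrightarrow> s ''out'' j = 0)"

text \<open>Kept apart from \<open>output_inv\<close> because it need not hold while the loads are
  being updated.\<close>

definition loads_inv :: "nat list \<Rightarrow> store \<Rightarrow> bool" where
  "loads_inv js s \<longleftrightarrow> (\<forall>i<n + m. s ''l'' i = load (greedy_select T k (copies js)) (ob i))"

lemma scanned_upd [simp]: "x \<notin> {''in'', ''g'', ''b'', ''h''} \<Longrightarrow> scanned (s(x := f)) = scanned s"
  by (auto simp: scanned_def)

lemma output_inv_upd [simp]: "x \<notin> {''in'', ''g'', ''b'', ''h'', ''out''} \<Longrightarrow>
    output_inv js (s(x := f)) = output_inv js s"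
  by (auto simp: output_inv_def output_sum)

lemma loads_inv_upd [simp]: "x \<noteq> ''l'' \<Longrightarrow> loads_inv js (s(x := f)) = loads_inv js s"
  by (simp add: loads_inv_def)

lemma entry_vals:
  assumes j: "j < q" and s: "scanned s" "s ''j'' 0 = j"
  shows "val s (entry (Num 0)) = mult j" "val s objs_exp = length (objs j)"
    "s ''i'' 0 = i \<Longrightarrow> i < length (objs j) \<Longrightarrow> val s obj_exp = objs j ! i"
    "s ''i'' 0 = i \<Longrightarrow> i < length (objs j) \<Longrightarrow> val s cap_exp = k (ob (objs j ! i))"
proof -
  have b: "s ''in'' = input" "s ''b'' j = start j" "s ''g'' 0 = 0" "s ''g'' (Suc 0) = n"
    using s j by (simp_all add: scanned_def inputs_def)
  show "val s (entry (Num 0)) = mult j" "val s objs_exp = length (objs j)"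
    using s b by (simp_all add: entry_simps[OF j] length_objs)
  show obj: "val s obj_exp = objs j ! i" if i: "s ''i'' 0 = i" "i < length (objs j)"
  proof (cases "i < length (verts j)")
    case True
    then have "Suc 0 - (length (verts j) - i) = 0" by simp
    then show ?thesis using True i s b by (simp add: entry_simps[OF j] objs_def nth_append)
  next
    case False
    then show ?thesis using i s b by (simp add: entry_simps[OF j] objs_def nth_append)
  qed
  show "val s cap_exp = k (ob (objs j ! i))" if i: "s ''i'' 0 = i" "i < length (objs j)"
  proof -
    have "val s cap_exp = input (5 + (m + (m + val s obj_exp)))" using b by simp
    moreover have "objs j ! i < n + m" using objs_less[OF j] i(2) by (meson lessThan_iff nth_mem subsetD)
    ultimately show ?thesis using obj[OF i] input_cap by simp
  qed
qed

lemma hoare_select: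
  assumes j: "j < q" "j \<notin> set js"
  shows "hoare (\<lambda>s. (output_inv js s \<and> loads_inv js s \<and> s ''y'' 0 = l) \<and> s ''j'' 0 = j) select_prog
    (6 + 6 * length (objs j))
    (\<lambda>s. (output_inv (js @ [j]) s \<and> loads_inv (js @ [j]) s \<and> s ''y'' 0 = l) \<and> s ''j'' 0 = j)"
proof -
  let ?U = "greedy_select T k (copies js)"
  let ?res = "\<lambda>i. k (ob i) - load ?U (ob i)"
  let ?len = "length (objs j)"
  let ?B = "\<lambda>s. output_inv js s \<and> s ''y'' 0 = l \<and> s ''j'' 0 = j"
  let ?I1 = "\<lambda>i s. ?B s \<and> loads_inv js s \<and> partial_min ?res (objs j) (mult j) i (s ''x'' 0)"
  \<comment> \<open>The loads are ahead of the output here: the first \<open>i\<close> objects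
    already count the new copies, which are recorded only afterwards.\<close>
  let ?I2 = "\<lambda>i s. ?B s \<and> partial_min ?res (objs j) (mult j) ?len (s ''x'' 0) \<and>
      (\<forall>a<n + m. s ''l'' a = load ?U (ob a) + (if a \<in> set (take i (objs j)) then s ''x'' 0 else 0))"
  have sc: "scanned s" if "output_inv js s" for s using that by (simp add: output_inv_def)
  note vals = entry_vals[OF j(1) sc]
  have obj_less: "objs j ! i < n + m" if "i < ?len" for i
    using objs_less[OF j(1)] that by (meson lessThan_iff nth_mem subsetD)
  have U: "load ?U (ob i) \<le> k (ob i)" if "i < n + m" for i
    using feasible_greedy[of "copies js"] that by (simp add: feasible_iff)
  have resid: "val s resid_exp = val s cap_exp - s ''l'' (val s obj_exp)" for s by simp
  have init: "hoare (\<lambda>s. (output_inv js s \<and> loads_inv js s \<and> s ''y'' 0 = l) \<and> s ''j'' 0 = j)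
      (Assign ''x'' (Num 0) (entry (Num 0))) 1 (?I1 0)"
    by (rule hoare_Assign_val[where A = "\<lambda>_. 0" and E = "\<lambda>_. mult j"])
      (use vals(1) in \<open>auto simp: partial_min_0 simp del: val.simps(2-4)\<close>)
  have min: "hoare (?I1 0) (For ''i'' objs_exp
      (Assign ''x'' (Num 0) (Monus (Var ''x'') (Monus (Var ''x'') resid_exp)))) (2 + ?len * (1 + 2)) (?I2 0)"
  proof (rule hoare_For[where I = ?I1 and n = 1 and N = ?len])
    fix i assume i: "i < ?len"
    show "hoare (\<lambda>s. ?I1 i s \<and> s ''i'' 0 = i)
        (Assign ''x'' (Num 0) (Monus (Var ''x'') (Monus (Var ''x'') resid_exp))) 1
        (\<lambda>s. ?I1 (Suc i) s \<and> s ''i'' 0 = i)"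
    proof (rule hoare_Assign_val)
      fix s assume s: "?I1 i s \<and> s ''i'' 0 = i"
      have "val s resid_exp = ?res (objs j ! i)"
        unfolding resid using s i vals(3,4)[of s i] obj_less[OF i] by (simp add: loads_inv_def del: val.simps)
      then show "val s (Monus (Var ''x'') (Monus (Var ''x'') resid_exp))
          = s ''x'' 0 - (s ''x'' 0 - ?res (objs j ! i))"
        by (simp only: val.simps(4)) simp
      show "?I1 (Suc i) (s(''x'' := (s ''x'')(0 := s ''x'' 0 - (s ''x'' 0 - ?res (objs j ! i))))) \<and>
          (s(''x'' := (s ''x'')(0 := s ''x'' 0 - (s ''x'' 0 - ?res (objs j ! i))))) ''i'' 0 = i"
        using s partial_min_Suc[of ?res "objs j" "mult j" i "s ''x'' 0"] by simp
    qed simp_all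
  next
    fix i s assume "?I1 i s" then show "val s objs_exp = ?len" using vals(2) by blast
  qed (auto simp: loads_inv_def)
  have update: "hoare (?I2 0) (For ''i'' objs_exp
      (Assign ''l'' obj_exp (Monus cap_exp (Monus resid_exp (Var ''x''))))) (2 + ?len * (1 + 2)) (?I2 ?len)"
  proof (rule hoare_For[where I = ?I2 and n = 1 and N = ?len])
    fix i assume i: "i < ?len"
    let ?o = "objs j ! i"
    have take: "set (take (Suc i) (objs j)) = insert ?o (set (take i (objs j)))"
      using i by (simp add: take_Suc_conv_app_nth)
    \<comment> \<open>The objects of an entry are distinct, so this cell still holds the old
      load.\<close>
    have new: "?o \<notin> set (take i (objs j))"
      using distinct_objs[OF j(1)] i distinct_take[of "objs j" "Suc i"]
      by (simp add: take_Suc_conv_app_nth)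
    show "hoare (\<lambda>s. ?I2 i s \<and> s ''i'' 0 = i)
        (Assign ''l'' obj_exp (Monus cap_exp (Monus resid_exp (Var ''x'')))) 1
        (\<lambda>s. ?I2 (Suc i) s \<and> s ''i'' 0 = i)"
    proof (rule hoare_Assign_val)
      fix s assume s: "?I2 i s \<and> s ''i'' 0 = i"
      show o: "val s obj_exp = ?o" using s i vals(3)[of s i] by blast
      have cap: "val s cap_exp = k (ob ?o)" using s i vals(4)[of s i] by blast
      have l: "s ''l'' ?o = load ?U (ob ?o)" using s new obj_less[OF i] by simp
      \<comment> \<open>Since \<open>x\<close> is at most the residual capacity, none of the
        truncated subtractions loses anything, and the assigned value is the old load plus
        \<open>x\<close>.\<close>
      have "s ''x'' 0 \<le> ?res ?o" using s i unfolding partial_min_length by simp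
      moreover have "val s (Monus cap_exp (Monus resid_exp (Var ''x'')))
          = k (ob ?o) - (k (ob ?o) - load ?U (ob ?o) - s ''x'' 0)"
        unfolding val.simps(4) o cap l val.simps(2)[of s "''l''"] by simp
      ultimately show "val s (Monus cap_exp (Monus resid_exp (Var ''x'')))
          = load ?U (ob ?o) + s ''x'' 0"
        using U[OF obj_less[OF i]] by linarith
      show "?I2 (Suc i) (s(''l'' := (s ''l'')(?o := load ?U (ob ?o) + s ''x'' 0))) \<and>
          (s(''l'' := (s ''l'')(?o := load ?U (ob ?o) + s ''x'' 0))) ''i'' 0 = i"
        using s by (auto simp: take)
    qed simp
  next
    fix i s assume "?I2 i s" then show "val s objs_exp = ?len" using vals(2) by blast
  qed auto
  have final: "hoare (?I2 ?len) (Assign ''out'' (Var ''j'') (Var ''x'')) 1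
      (\<lambda>s. (output_inv (js @ [j]) s \<and> loads_inv (js @ [j]) s \<and> s ''y'' 0 = l) \<and> s ''j'' 0 = j)"
  proof (rule hoare_Assign)
    fix s assume s: "?I2 ?len s"
    let ?s = "s(''out'' := (s ''out'')(j := s ''x'' 0))"
    have sel: "greedy_select T k (copies (js @ [j])) = ?U + replicate_mset (s ''x'' 0) (graph j)"
      using s by (intro greedy_select_copies[OF j(1)]) blast
    have "s ''out'' j = 0" using s j by (simp add: output_inv_def)
    then have "output_inv (js @ [j]) ?s"
      using s output_upd[OF j(1), of s "s ''x'' 0"] by (auto simp: output_inv_def sel)
    moreover have "loads_inv (js @ [j]) ?s"
      using s ob_in_graph[OF j(1)] by (simp add: loads_inv_def sel)
    ultimately show "(output_inv (js @ [j]) (s(''out'' := (s ''out'')(val s (Var ''j'') := val s (Var ''x'')))) \<and>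
        loads_inv (js @ [j]) (s(''out'' := (s ''out'')(val s (Var ''j'') := val s (Var ''x'')))) \<and>
        (s(''out'' := (s ''out'')(val s (Var ''j'') := val s (Var ''x'')))) ''y'' 0 = l) \<and>
        (s(''out'' := (s ''out'')(val s (Var ''j'') := val s (Var ''x'')))) ''j'' 0 = j"
      using s by simp
  qed simp
  show ?thesis
    unfolding select_prog_def
    by (rule hoare_Seq[OF init hoare_Seq[OF min hoare_Seq[OF update final order_refl] order_refl]]) simp
qed


subsection \<open>The order of selection\<close>

definition level :: "nat \<Rightarrow> nat" where
  "level j = deepest_root_first T r (graph j)"

lemma level_eq_iff:
  assumes "j < q"
  shows "level j < n" "level j = l \<longleftrightarrow> Suc (depth (top_of (graph j))) + l = n"
proof -
  have "top_of (graph j) \<in> vertices T"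
    using top_of(1)[OF subtree_graph[OF assms]] subtree_graph[OF assms] by (auto simp: subtree_def)
  then have "depth (top_of (graph j)) < n"
    using depth_less_card by (simp add: vertices_T)
  then show "level j < n" "level j = l \<longleftrightarrow> Suc (depth (top_of (graph j))) + l = n"
    by (auto simp: level_def deepest_root_first_def vertices_T)
qed

text \<open>The processed entries at the moment when pass \<open>l\<close> arrives at entry
  \<open>j\<close>. The end of one pass is the start of the next, by \<open>order_Suc_0\<close>, so
  the same list serves the inner and the outer loop.\<close>

definition order :: "nat \<Rightarrow> nat \<Rightarrow> nat list" where
  "order l j = concat (map (\<lambda>l. filter (\<lambda>j. level j = l) [0..<q]) [0..<l])
     @ filter (\<lambda>j. level j = l) [0..<j]"

lemma order_Suc: "order l (Suc j) = (if level j = l then order l j @ [j] else order l j)"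
  and order_Suc_0: "order (Suc l) 0 = order l q"
  by (simp_all add: order_def)

lemma not_in_order: "level j = l \<Longrightarrow> j \<notin> set (order l j)"
  by (auto simp: order_def)

lemma mset_order: "mset (order l 0) = mset (filter (\<lambda>j. level j < l) [0..<q])"
proof (induction l)
  case (Suc l)
  have "mset (filter (\<lambda>j. level j < l) xs) + mset (filter (\<lambda>j. level j = l) xs)
      = mset (filter (\<lambda>j. level j < Suc l) xs)" for xs
    by (induction xs) auto
  moreover have "order (Suc l) 0 = order l 0 @ filter (\<lambda>j. level j = l) [0..<q]"
    by (simp add: order_def)
  ultimately show ?case by (simp only: mset_append Suc)
qed (simp add: order_def)

lemma sorted_order: "sorted (map level (order l 0))"
proof (induction l)
  case (Suc l)
  have "order (Suc l) 0 = order l 0 @ filter (\<lambda>j. level j = l) [0..<q]"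
    by (simp add: order_def)
  moreover have "map level (filter (\<lambda>j. level j = l) xs) = replicate (length (filter (\<lambda>j. level j = l) xs)) l" for xs
    by (induction xs) auto
  moreover have "level j \<le> l" if "j \<in> set (order l 0)" for j
    using that by (auto simp: order_def)
  ultimately show ?case using Suc by (auto simp: sorted_append)
qed (simp add: order_def)

lemma sorted_copies: "sorted (map level js) \<Longrightarrow> sorted (map (deepest_root_first T r) (copies js))"
proof (induction js)
  case (Cons j js)
  then show ?case by (auto simp: copies_def sorted_append level_def)
qed (simp add: copies_def)

lemma mset_copies: "mset (copies js) = (\<Sum>j\<in>#mset js. replicate_mset (mult j) (graph j))"
  by (induction js) (simp_all add: copies_def)

text \<open>All ranks are below \<open>n\<close>, so \<open>n\<close> passes list every entry once.
  Ties may be broken in any way, in particular by position in the code with the copies of an entry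
  adjacent.\<close>

lemma greedy_select_order:
  "greedy_select T k (copies (order n 0)) \<in> greedy_outputs deepest_root_first T r \<T> k"
proof -
  have "filter (\<lambda>j. level j < n) [0..<q] = [0..<q]"
    using level_eq_iff(1) by (simp add: filter_id_conv)
  then have "mset (order n 0) = mset [0..<q]"
    by (simp only: mset_order)
  then have "mset (copies (order n 0)) = (\<Sum>j\<in>#mset [0..<q]. replicate_mset (mult j) (graph j))"
    by (simp only: mset_copies)
  also have "\<dots> = \<T>"
    by (simp add: multiset_sum sum_unfold_sum_mset atLeast0LessThan)
  finally show ?thesis
    unfolding greedy_outputs_def using sorted_copies[OF sorted_order] by blast
qed

lemma hoare_main:
  "hoare (\<lambda>s. scanned s \<and> fresh s) main_prog (2 + n * (2 + q * (7 + 6 * N + 2) + 2))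
     (\<lambda>s. multiset_of (listed_graphs c) (output_list q s) \<in> greedy_outputs deepest_root_first T r \<T> k)"
proof -
  let ?I = "\<lambda>l j s. output_inv (order l j) s \<and> loads_inv (order l j) s"
  have in_s: "s ''in'' = input" if "output_inv js s" for s js
    using that by (simp add: output_inv_def scanned_def in_eq)
  have lev: "val s level_exp = 0 \<longleftrightarrow> level j = l"
    if "output_inv js s" "s ''j'' 0 = j" "s ''y'' 0 = l" "j < q" for s js j l
  proof -
    have "s ''h'' j = Suc (depth (top_of (graph j)))" using that by (simp add: output_inv_def scanned_def)
    then show ?thesis using that in_s[OF that(1)] by (auto simp: level_eq_iff(2))
  qed
  have body: "hoare (\<lambda>s. (output_inv (order l j) s \<and> loads_inv (order l j) s \<and> s ''y'' 0 = l) \<and> s ''j'' 0 = j)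
      (If level_exp Skip select_prog) (7 + 6 * N)
      (\<lambda>s. (output_inv (order l (Suc j)) s \<and> loads_inv (order l (Suc j)) s \<and> s ''y'' 0 = l) \<and> s ''j'' 0 = j)"
    if j: "j < q" for l j
  proof (rule hoare_If[where n = "6 + 6 * N"])
    let ?P = "\<lambda>s. (output_inv (order l j) s \<and> loads_inv (order l j) s \<and> s ''y'' 0 = l) \<and> s ''j'' 0 = j"
    let ?Q = "\<lambda>s. (output_inv (order l (Suc j)) s \<and> loads_inv (order l (Suc j)) s \<and> s ''y'' 0 = l) \<and> s ''j'' 0 = j"
    show "hoare (\<lambda>s. ?P s \<and> val s level_exp \<noteq> 0) Skip (6 + 6 * N) ?Q"
    proof (rule hoare_Skip)
      fix s assume s: "?P s \<and> val s level_exp \<noteq> 0"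
      then have a: "output_inv (order l j) s" "s ''j'' 0 = j" "s ''y'' 0 = l" "val s level_exp \<noteq> 0"
        by blast+
      have "level j \<noteq> l" using a(4) unfolding lev[OF a(1-3) j] .
      then show "?Q s" using s by (simp add: order_Suc)
    qed simp
    show "hoare (\<lambda>s. ?P s \<and> val s level_exp = 0) select_prog (6 + 6 * N) ?Q"
    proof (cases "level j = l")
      case True
      then show ?thesis
        using sizes(4)[OF j] unfolding order_Suc
        by (intro hoare_conseq[OF hoare_select[OF j not_in_order[OF True], of l]]) auto
    next
      case False
      \<comment> \<open>The guard vanishes only for entries of rank \<open>l\<close>, so the
        precondition is contradictory.\<close>
      show ?thesis
      proof (rule hoareI)
        fix s assume "?P s \<and> val s level_exp = 0"
        then have a: "output_inv (order l j) s" "s ''j'' 0 = j" "s ''y'' 0 = l" "val s level_exp = 0"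
          by blast+
        have "level j = l" using a(4) unfolding lev[OF a(1-3) j] .
        with False show "\<exists>i s'. steps select_prog s i s' \<and> i \<le> 6 + 6 * N \<and> ?Q s'" ..
      qed
    qed
  qed simp
  have inner: "hoare (\<lambda>s. ?I l 0 s \<and> s ''y'' 0 = l) (For ''j'' (In (Num 3)) (If level_exp Skip select_prog))
      (2 + q * (7 + 6 * N + 2)) (\<lambda>s. ?I (Suc l) 0 s \<and> s ''y'' 0 = l)" for l
    by (rule hoare_For[where I = "\<lambda>j s. output_inv (order l j) s \<and> loads_inv (order l j) s \<and> s ''y'' 0 = l"
        and N = q, OF body]) (auto simp: in_s order_Suc_0)
  have init: "?I 0 0 s" if "scanned s \<and> fresh s" for s
    using that
    by (auto simp: output_inv_def loads_inv_def fresh_def output_sum order_def copies_def greedy_select_def)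
  have final: "multiset_of (listed_graphs c) (output_list q s) \<in> greedy_outputs deepest_root_first T r \<T> k"
    if "output_inv (order n 0) s" for s
    using that greedy_select_order by (simp add: output_inv_def)
  show ?thesis
    unfolding main_prog_def
    by (rule hoare_For[where I = "\<lambda>l. ?I l 0" and N = n, OF inner])
      (use init final in \<open>auto simp: in_s\<close>)
qed

lemma greedy_prog_steps:
  "\<exists>l s. steps greedy_prog (input_store (code_list c)) l s \<and> l \<le> poly [:9, 15, 20, 6:] N \<and>
    multiset_of (listed_graphs c) (output_list q s) \<in> greedy_outputs deepest_root_first T r \<T> k"
proof -
  let ?s = "input_store (code_list c)"
  let ?D = "1 + (2 + n * (2 + m * 8 + 2))" and ?S = "1 + (2 + q * (5 + 3 * N + 2))"
    and ?M = "2 + n * (2 + q * (7 + 6 * N + 2) + 2)"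
  let ?Q = "\<lambda>s. multiset_of (listed_graphs c) (output_list q s) \<in> greedy_outputs deepest_root_first T r \<T> k"
  have "hoare (\<lambda>s. s = ?s) (Assign ''g'' (Num 1) (In (Num 1))) 1
      (\<lambda>s. inputs s \<and> fresh s \<and> (\<forall>v. s ''d'' v = 0))"
    by (rule hoare_Assign)
      (use input_header in \<open>auto simp: inputs_def fresh_def input_def[symmetric]\<close>,
        auto simp: input_store_def)
  then have "hoare (\<lambda>s. s = ?s) greedy_prog (1 + (?D + (?S + ?M))) ?Q"
    unfolding greedy_prog_def
    by (rule hoare_Seq[OF _ hoare_Seq[OF hoare_depths hoare_Seq[OF hoare_scan hoare_main order_refl] order_refl]]) simp
  from hoareD[OF this refl] obtain l s where ls: "steps greedy_prog ?s l s" "l \<le> 1 + (?D + (?S + ?M))" "?Q s"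
    by blast
  have "?D \<le> 1 + (2 + N * (2 + N * 8 + 2))" "?S \<le> 1 + (2 + N * (5 + 3 * N + 2))"
    "?M \<le> 2 + N * (2 + N * (7 + 6 * N + 2) + 2)"
    by ((intro add_left_mono mult_le_mono add_mono order_refl sizes(1-3))+)
  then have "1 + (?D + (?S + ?M)) \<le> 1 + (1 + (2 + N * (2 + N * 8 + 2)) + (1 + (2 + N * (5 + 3 * N + 2))
      + (2 + N * (2 + N * (7 + 6 * N + 2) + 2))))"
    by (rule add_left_mono[OF add_mono[OF _ add_mono]])
  \<comment> \<open>The coefficients come from expanding the preceding bound; the cubic term is the
    selection over ranks, entries and objects.\<close>
  also have "\<dots> \<le> poly [:9, 15, 20, 6:] N" by (simp add: algebra_simps)
  finally show ?thesis using ls by (intro exI[of _ l] exI[of _ s]) simp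
qed

end

text \<open>The ratio is established for every legal run of the rule, so it covers the particular
  tie-breaking that the program realises.\<close>

theorem theorem4:
  "\<exists>rule :: nat rule.
     (\<forall>T r \<T> k. mstbl_instance T \<T> k \<and> r \<in> vertices T \<longrightarrow>
        (\<forall>U \<in> greedy_outputs rule T r \<T> k.
           U \<subseteq># \<T> \<and> feasible T k U \<and>
           (\<forall>OPT. optimal T \<T> k OPT \<longrightarrow> size OPT \<le> max 1 (max_leaves T r \<T>) * size U))) \<and>
     (\<exists>(P :: prog) (p :: nat poly). \<forall>c T r \<T> k.
        mstbl_instance T \<T> k \<and> r \<in> vertices T \<and> encodes c T r \<T> k \<longrightarrow>
        (\<exists>t s. exec P (input_store (code_list c)) t s \<and>
               t \<le> poly p (input_size (code_list c)) \<and>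
               multiset_of (listed_graphs c) (output_list (length (subs c)) s)
                 \<in> greedy_outputs rule T r \<T> k))"
proof -
  obtain b :: "nat poly" where b: "\<And>xs l s. steps greedy_prog (input_store xs) l s \<Longrightarrow>
      l \<le> poly [:9, 15, 20, 6:] (input_size xs) \<Longrightarrow>
      \<exists>t. exec greedy_prog (input_store xs) t s \<and> t \<le> poly b (input_size xs)"
    using tame_polynomial_time[OF tame_greedy_prog, of "[:9, 15, 20, 6:]"] by blast
  have "\<exists>t s. exec greedy_prog (input_store (code_list c)) t s \<and> t \<le> poly b (input_size (code_list c)) \<and>
      multiset_of (listed_graphs c) (output_list (length (subs c)) s)
        \<in> greedy_outputs deepest_root_first T r \<T> k"
    if "mstbl_instance T \<T> k \<and> r \<in> vertices T \<and> encodes c T r \<T> k" for c T r \<T> k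
  proof -
    interpret encoded_instance c T r \<T> k
      using that by unfold_locales auto
    show ?thesis using greedy_prog_steps b unfolding N_def by blast
  qed
  then show ?thesis
  proof (intro exI[of _ deepest_root_first] exI[of _ greedy_prog] exI[of _ b] conjI allI impI ballI)
    fix T :: "nat graph" and r \<T> k U
    assume h: "mstbl_instance T \<T> k \<and> r \<in> vertices T"
      and U: "U \<in> greedy_outputs deepest_root_first T r \<T> k"
    note approx = deepest_root_first_approx[OF conjunct1[OF h] conjunct2[OF h] U]
    show "U \<subseteq># \<T>" "feasible T k U" by (rule approx)+
    show "size OPT \<le> max 1 (max_leaves T r \<T>) * size U" if "optimal T \<T> k OPT" for OPT
      using that by (rule approx)
  qed
qed

end
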